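(* (i) Let $G$ be a Cayley graph of an infinite, finitely generated group with respect to a finite generating set, and let $\mu$ be a non-atomic probability measure supported on $[0,\infty)$ with finite mean. Then for every $x\in G$, \[ \widehat{\mathbf E}\big[\phi_G\big(h(\widehat T(x))\big)\big]=\infty , \] where $\phi_G(n)$ is the number of vertices of a graph-distance ball of radius $n$ in $G$. In particular, for $G=\mathbb Z$ one has $\widehat{\mathbf E}[h(\widehat T(x))]=\infty$. (ii) Let $G=\mathbb Z^d$, and let $\mu$ be a non-atomic probability measure supported on $[0,\infty)$ such that $\int e^{\nu s}\,\mu(ds)<\infty$ for some $\nu>0$. Then for every $x\in G$, $\overline{\mathbf E}\big[h(\overline T(x))^d\big]=\infty$.
   Context: Cayley graph: vertices are the group elements, and $x,y$ are neighbors iff $y=xs$ for some $s$ in a fixed finite symmetric generating set not containing the identity; $\mathbb Z$ and $\mathbb Z^d$ ($d\ge1$) carry the nearest-neighbor graph structure. $\mathbb Z_+=\{0,1,2,\dots\}$. Directed graph $\widehat G$: vertex set $G\times\mathbb Z_+$; there is a directed edge from $(y,n+1)$ to $(x,n)$ for every $n\ge 0$ and every pair of neighbors $x,y$ in $G$; no other edges. Paths in $\widehat G$ are directed. Undirected graph $\overline G$: vertex set $G\times\mathbb Z_+$; $(x,m)$ and $(y,n)$ are joined by an edge iff either $x,y$ are neighbors in $G$ and $m=n\ge 1$, or $x=y$ and $|m-n|=1$. (There are no edges inside level $0$.) $G$ is identified with level $0$, i.e. with $\{(x,0):x\in G\}$. The edges of $\widehat G$ (resp. $\overline G$) carry i.i.d.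 weights $\omega(e)$ with law $\mu$; the product measure is $\widehat{\mathbf P}$ (resp. $\overline{\mathbf P}$), with expectation $\widehat{\mathbf E}$ (resp. $\overline{\mathbf E}$). For a (directed, in the case of $\widehat G$) path $\gamma$ put $\lambda(\gamma)=\sum_{e\in\gamma}\omega(e)$; the passage time $d_\omega(u,v)$ is the infimum of $\lambda(\gamma)$ over paths $\gamma$ from $u$ to $v$ ($\infty$ if there is none), and $d_\omega(u,G)=\inf_{x\in G}d_\omega(u,(x,0))$. Since $\mu$ has no atoms, almost surely each vertex $u$ has a unique path (geodesic) to $G$ with weight $d_\omega(u,G)$. For $x\in G$, the tree $T(x)$ ($\widehat T(x)$ in $\widehat G$, $\overline T(x)$ in $\overline G$) is the union of all geodesics from vertices $u$ to $G$ that end at $(x,0)$. For a set of vertices $S\subset G\times\mathbb Z_+$, the height is $h(S)=\max\{j:\exists y\in G,\ (y,j)\in S\}$. *)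

theory Defs
  imports
    "HOL-Probability.Probability"
    "HOL-Algebra.Generated_Groups"
    "Graph_Theory.Pair_Digraph"
begin

text \<open>
  Undirected graphs are represented, as usual in \<open>Graph_Theory\<close>, by symmetric digraphs
  (every edge contributes both arcs); \<open>apath\<close> is the notion of a path without repeated vertices.
\<close>

definition cayley_generators :: "('a, 'b) monoid_scheme \<Rightarrow> 'a set \<Rightarrow> bool" where
  "cayley_generators G S \<longleftrightarrow>
     finite S \<and> S \<subseteq> carrier G \<and> generate G S = carrier G \<and>
     (\<forall>s\<in>S. inv\<^bsub>G\<^esub> s \<in> S) \<and> \<one>\<^bsub>G\<^esub> \<notin> S"

definition cayley_graph :: "('a, 'b) monoid_scheme \<Rightarrow> 'a set \<Rightarrow> 'a pair_pre_digraph" where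
  "cayley_graph G S =
     \<lparr> pverts = carrier G,
       parcs = {(x, y). x \<in> carrier G \<and> (\<exists>s\<in>S. y = x \<otimes>\<^bsub>G\<^esub> s)} \<rparr>"

definition int_graph :: "int pair_pre_digraph" where
  "int_graph = \<lparr> pverts = UNIV, parcs = {(x, y). \<bar>x - y\<bar> = 1} \<rparr>"

definition lattice_graph :: "(int ^ 'd) pair_pre_digraph" where
  "lattice_graph = \<lparr> pverts = UNIV, parcs = {(x, y). (\<Sum>i\<in>UNIV. \<bar>x $ i - y $ i\<bar>) = 1} \<rparr>"

definition graph_ball :: "'a pair_pre_digraph \<Rightarrow> 'a \<Rightarrow> nat \<Rightarrow> 'a set" where
  "graph_ball \<Gamma> z n =
     {y. \<exists>p. pre_digraph.apath (with_proj \<Gamma>) z p y \<and> length p \<le> n}"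

text \<open>
  The number of vertices of the ball of radius \<open>n\<close> around \<open>z\<close> (in a Cayley graph it does not
  depend on \<open>z\<close>). A tree may a priori have infinite height; the value at \<open>\<infinity>\<close>
  is the limit of the ball sizes in an infinite connected graph.
\<close>
definition ball_size :: "'a pair_pre_digraph \<Rightarrow> 'a \<Rightarrow> enat \<Rightarrow> ennreal" where
  "ball_size \<Gamma> z n = (case n of enat k \<Rightarrow> of_nat (card (graph_ball \<Gamma> z k)) | \<infinity> \<Rightarrow> \<infinity>)"

definition directed_ext :: "'a pair_pre_digraph \<Rightarrow> ('a \<times> nat) pair_pre_digraph" where
  "directed_ext \<Gamma> =
     \<lparr> pverts = pverts \<Gamma> \<times> UNIV,
       parcs = {((y, Suc n), (x, n)) | x y n. (x, y) \<in> parcs \<Gamma>} \<rparr>"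

definition undirected_ext :: "'a pair_pre_digraph \<Rightarrow> ('a \<times> nat) pair_pre_digraph" where
  "undirected_ext \<Gamma> =
     \<lparr> pverts = pverts \<Gamma> \<times> UNIV,
       parcs = {((x, m), (y, n)) | x m y n.
                  (x, y) \<in> parcs \<Gamma> \<and> m = n \<and> n \<ge> 1 \<or>
                  x \<in> pverts \<Gamma> \<and> x = y \<and> \<bar>int m - int n\<bar> = 1} \<rparr>"

definition undirected_edges :: "'v pair_pre_digraph \<Rightarrow> 'v set set" where
  "undirected_edges H = {{u, v} | u v. (u, v) \<in> parcs H}"

definition passage_time :: "'v pair_pre_digraph \<Rightarrow> ('v \<times> 'v \<Rightarrow> real) \<Rightarrow> 'v \<Rightarrow> 'v \<Rightarrow> ereal" where
  "passage_time H c u v =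
     (INF p\<in>{p. pre_digraph.apath (with_proj H) u p v}. ereal (sum_list (map c p)))"

definition passage_time_base ::
    "('a \<times> nat) pair_pre_digraph \<Rightarrow> (('a \<times> nat) \<times> ('a \<times> nat) \<Rightarrow> real) \<Rightarrow> 'a \<times> nat \<Rightarrow> ereal" where
  "passage_time_base H c u = (INF v\<in>{v \<in> pverts H. snd v = 0}. passage_time H c u v)"

definition geodesic_to ::
    "('a \<times> nat) pair_pre_digraph \<Rightarrow> (('a \<times> nat) \<times> ('a \<times> nat) \<Rightarrow> real) \<Rightarrow>
     'a \<times> nat \<Rightarrow> (('a \<times> nat) \<times> ('a \<times> nat)) list \<Rightarrow> 'a \<Rightarrow> bool" where
  "geodesic_to H c u p x \<longleftrightarrow>
     pre_digraph.apath (with_proj H) u p (x, 0) \<and>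
     ereal (sum_list (map c p)) = passage_time_base H c u"

text \<open>The vertex set of the tree; the empty path from \<open>(x, 0)\<close> to itself is allowed.\<close>
definition geodesic_tree ::
    "('a \<times> nat) pair_pre_digraph \<Rightarrow> (('a \<times> nat) \<times> ('a \<times> nat) \<Rightarrow> real) \<Rightarrow> 'a \<Rightarrow> ('a \<times> nat) set" where
  "geodesic_tree H c x =
     \<Union> {set (pre_digraph.awalk_verts (with_proj H) u p) | u p. geodesic_to H c u p x}"

definition height :: "('a \<times> nat) set \<Rightarrow> enat" where
  "height T = (SUP v\<in>T. enat (snd v))"

definition directed_env ::
    "'a pair_pre_digraph \<Rightarrow> real measure \<Rightarrow> (('a \<times> nat) \<times> ('a \<times> nat) \<Rightarrow> real) measure" where
  "directed_env \<Gamma> M = PiM (parcs (directed_ext \<Gamma>)) (\<lambda>_. M)"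

definition undirected_env ::
    "'a pair_pre_digraph \<Rightarrow> real measure \<Rightarrow> (('a \<times> nat) set \<Rightarrow> real) measure" where
  "undirected_env \<Gamma> M = PiM (undirected_edges (undirected_ext \<Gamma>)) (\<lambda>_. M)"

definition directed_tree ::
    "'a pair_pre_digraph \<Rightarrow> (('a \<times> nat) \<times> ('a \<times> nat) \<Rightarrow> real) \<Rightarrow> 'a \<Rightarrow> ('a \<times> nat) set" where
  "directed_tree \<Gamma> \<omega> x = geodesic_tree (directed_ext \<Gamma>) \<omega> x"

text \<open>Both arcs of an undirected edge carry the single weight of that edge.\<close>
definition undirected_tree ::
    "'a pair_pre_digraph \<Rightarrow> (('a \<times> nat) set \<Rightarrow> real) \<Rightarrow> 'a \<Rightarrow> ('a \<times> nat) set" where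
  "undirected_tree \<Gamma> \<omega> x = geodesic_tree (undirected_ext \<Gamma>) (\<lambda>(u, v). \<omega> {u, v}) x"

text \<open>For Borel laws on the line, having no atoms means having no point masses.\<close>
definition nonatomic_weight_law :: "real measure \<Rightarrow> bool" where
  "nonatomic_weight_law M \<longleftrightarrow>
     real_distribution M \<and> (\<forall>s. emeasure M {s} = 0) \<and> (AE s in M. 0 \<le> s)"

end

theory Submission
  imports Defs
begin

text \<open>
  Mass transport: a vertex of level \<open>n\<close> lies in the tree of the endpoint of its geodesic. By
  translation invariance, the expected number of vertices of level \<open>n\<close> whose geodesic has at most
  \<open>K\<close> edges and ends at \<open>(x, 0)\<close> is at least the probability \<open>\<delta>\<close> that the geodesic from
  \<open>(\<one>, n)\<close> has at most \<open>K\<close> edges. Such vertices lie over a ball of radius \<open>K\<close>, so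
  \<open>\<bar>B(K)\<bar> \<cdot> P(h \<ge> n) \<ge> \<delta>\<close>. This contradicts \<open>E(\<phi>(h)) < \<infinity>\<close> when \<open>\<bar>B(K)\<bar> \<le> C \<cdot> \<phi>(n)\<close>,
  because integrability forces \<open>\<phi>(n) \<cdot> P(h \<ge> n) \<rightarrow> 0\<close>.

  In the directed graph all paths from level \<open>n\<close> have \<open>n\<close> edges, so \<open>K = n\<close> and \<open>\<delta> = 1\<close>. In the
  undirected graph one takes \<open>K = c \<cdot> n\<close> and \<open>\<delta> = 1/2\<close>: by Markov's inequality the vertical path
  from \<open>(\<one>, n)\<close> has weight \<open>O(n)\<close>, whereas by a Chernoff bound and a count of paths every path
  has weight at least a constant multiple of its length.
\<close>

section \<open>Walks and balls\<close>

text \<open>Splitting off the first arc leaves at most \<open>D\<close> choices per step. Finiteness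
  makes the paths from a vertex countable; the bound \<open>D ^ k\<close> is the entropy term that
  the Chernoff estimate has to beat.\<close>

lemma (in pair_wf_digraph) finite_awalks_of_length:
  assumes deg: "\<And>u. u \<in> pverts G \<Longrightarrow> finite {v. (u, v) \<in> parcs G} \<and> card {v. (u, v) \<in> parcs G} \<le> D"
    and "u \<in> pverts G"
  shows "finite {p. length p = k \<and> (\<exists>v. awalk u p v)} \<and>
    card {p. length p = k \<and> (\<exists>v. awalk u p v)} \<le> D ^ k"
  using \<open>u \<in> pverts G\<close>
proof (induction k arbitrary: u)
  case 0
  have "{p. length p = 0 \<and> (\<exists>v. awalk u p v)} = {[]}"
    using 0 by (auto simp: awalk_Nil_iff)
  then show ?case by simp
next
  case (Suc k)
  let ?W = "\<lambda>u k. {p. length p = k \<and> (\<exists>v. awalk u p v)}"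
  let ?N = "{v. (u, v) \<in> parcs G}"
  have sub: "?W u (Suc k) \<subseteq> (\<Union>w\<in>?N. (#) (u, w) ` ?W w k)"
  proof
    fix p assume p: "p \<in> ?W u (Suc k)"
    then obtain e q where pq: "p = e # q" by (cases p) auto
    with p obtain v where "awalk u (e # q) v" by auto
    then have e: "e \<in> parcs G" "u = fst e" and q: "awalk (snd e) q v"
      by (auto simp: awalk_Cons_iff)
    then show "p \<in> (\<Union>w\<in>?N. (#) (u, w) ` ?W w k)"
      using p pq by (intro UN_I[of "snd e"] image_eqI[of _ _ q]) auto
  qed
  have N: "finite ?N" "card ?N \<le> D" using deg[OF Suc.prems] by auto
  have W: "finite (?W w k)" "card (?W w k) \<le> D ^ k" if "w \<in> ?N" for w
    using Suc.IH[of w] in_arcsD2 that by auto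
  have fin: "finite (\<Union>w\<in>?N. (#) (u, w) ` ?W w k)" using N W by blast
  have "card (?W u (Suc k)) \<le> card (\<Union>w\<in>?N. (#) (u, w) ` ?W w k)"
    by (rule card_mono[OF fin sub])
  also have "\<dots> \<le> (\<Sum>w\<in>?N. card ((#) (u, w) ` ?W w k))"
    by (rule card_UN_le[OF N(1)])
  also have "\<dots> \<le> (\<Sum>w\<in>?N. D ^ k)"
    using W by (intro sum_mono) (meson card_image_le order_trans)
  also have "\<dots> \<le> D ^ Suc k" using N(2) by simp
  finally show ?case using finite_subset[OF sub fin] by simp
qed

text \<open>Each step of loop erasure cuts a cycle out of the walk, which can only shorten
  it.\<close>

lemma (in wf_digraph) length_awalk_to_apath_le:
  assumes "awalk u p v"
  shows "length (awalk_to_apath p) \<le> length p"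
  using assms
proof (induct rule: awalk_to_apath_induct)
  case (path p)
  then have "awalk_to_apath p = p" by (auto simp: awalk_to_apath.simps)
  then show ?case by simp
next
  case (decomp p q r s)
  have "awalk_to_apath p = awalk_to_apath (q @ s)"
    using decomp by (intro step_awalk_to_apath) auto
  moreover have "length (q @ s) \<le> length p"
    using decomp by (auto elim!: awalk_cyc_decompE)
  ultimately show ?case using decomp by simp
qed

lemma (in pair_wf_digraph) awalk_hom:
  assumes "pair_wf_digraph G'" and verts: "\<And>v. v \<in> pverts G \<Longrightarrow> f v \<in> pverts G'"
    and arcs: "\<And>u v. (u, v) \<in> parcs G \<Longrightarrow> (f u, f v) \<in> parcs G'"
    and "awalk u p v"
  shows "pre_digraph.awalk (with_proj G') (f u) (map (map_prod f f) p) (f v)"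
proof -
  interpret G': pair_wf_digraph G' by fact
  show ?thesis
    using \<open>awalk u p v\<close>
  proof (induction p arbitrary: u)
    case Nil
    then show ?case by (auto simp: awalk_Nil_iff G'.awalk_Nil_iff verts)
  next
    case (Cons a p)
    then have a: "a \<in> parcs G" "u = fst a" and p: "awalk (snd a) p v"
      by (auto simp: awalk_Cons_iff)
    show ?case
      using Cons.IH[OF p] a arcs[of "fst a" "snd a"]
      by (cases a) (auto simp: G'.awalk_Cons_iff)
  qed
qed

text \<open>Paths project and translate more easily as walks, since a projection may repeat
  vertices. Loop erasure makes the two descriptions of a ball agree.\<close>

lemma (in pair_wf_digraph) graph_ball_awalk:
  "graph_ball G z n = {y. \<exists>p. awalk z p y \<and> length p \<le> n}"
proof (intro antisym subsetI)
  fix y assume "y \<in> graph_ball G z n"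
  then show "y \<in> {y. \<exists>p. awalk z p y \<and> length p \<le> n}"
    unfolding graph_ball_def using awalkI_apath by blast
next
  fix y assume "y \<in> {y. \<exists>p. awalk z p y \<and> length p \<le> n}"
  then obtain p where p: "awalk z p y" "length p \<le> n" by auto
  then have "apath z (awalk_to_apath p) y \<and> length (awalk_to_apath p) \<le> n"
    using apath_awalk_to_apath[OF p(1)] length_awalk_to_apath_le[OF p(1)] by simp
  then show "y \<in> graph_ball G z n"
    unfolding graph_ball_def mem_Collect_eq by (rule exI)
qed

lemma graph_ball_mono: "m \<le> n \<Longrightarrow> graph_ball \<Gamma> z m \<subseteq> graph_ball \<Gamma> z n"
  unfolding graph_ball_def using le_trans by (intro Collect_mono) blast

lemma (in group) pair_wf_digraph_cayley_graph:
  "S \<subseteq> carrier G \<Longrightarrow> pair_wf_digraph (cayley_graph G S)"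
  by unfold_locales (auto simp: cayley_graph_def)

lemma (in group) finite_graph_ball_cayley:
  assumes "finite S" "S \<subseteq> carrier G" "z \<in> carrier G"
  shows "finite (graph_ball (cayley_graph G S) z n)"
proof -
  interpret \<Gamma>: pair_wf_digraph "cayley_graph G S"
    by (rule pair_wf_digraph_cayley_graph) fact
  have deg: "finite {v. (u, v) \<in> parcs (cayley_graph G S)} \<and>
      card {v. (u, v) \<in> parcs (cayley_graph G S)} \<le> card S"
    if "u \<in> pverts (cayley_graph G S)" for u
  proof -
    have "{v. (u, v) \<in> parcs (cayley_graph G S)} = (\<lambda>s. u \<otimes> s) ` S"
      using that by (auto simp: cayley_graph_def)
    then show ?thesis using assms(1) by (simp add: card_image_le)
  qed
  have z: "z \<in> pverts (cayley_graph G S)" using assms by (simp add: cayley_graph_def)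
  have "graph_ball (cayley_graph G S) z n \<subseteq>
      (\<Union>k\<in>{..n}. (\<lambda>p. last (pawalk_verts z p)) ` {p. length p = k \<and> (\<exists>v. \<Gamma>.awalk z p v)})"
  proof
    fix y assume "y \<in> graph_ball (cayley_graph G S) z n"
    then obtain p where "\<Gamma>.awalk z p y" "length p \<le> n"
      unfolding \<Gamma>.graph_ball_awalk by auto
    then show "y \<in> (\<Union>k\<in>{..n}. (\<lambda>p. last (pawalk_verts z p)) ` {p. length p = k \<and> (\<exists>v. \<Gamma>.awalk z p v)})"
      by (intro UN_I[of "length p"] image_eqI[of _ _ p]) auto
  qed
  then show ?thesis
    by (rule finite_subset) (intro finite_UN_I finite_imageI finite_atMost
        conjunct1[OF \<Gamma>.finite_awalks_of_length[OF deg z]])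
qed

lemma (in group) graph_ball_cayley_translate:
  assumes "S \<subseteq> carrier G" "g \<in> carrier G" "y \<in> graph_ball (cayley_graph G S) z n"
  shows "g \<otimes> y \<in> graph_ball (cayley_graph G S) (g \<otimes> z) n"
proof -
  interpret \<Gamma>: pair_wf_digraph "cayley_graph G S"
    by (rule pair_wf_digraph_cayley_graph) fact
  obtain p where p: "\<Gamma>.awalk z p y" "length p \<le> n"
    using assms(3) unfolding \<Gamma>.graph_ball_awalk by auto
  have arcs: "(g \<otimes> u, g \<otimes> v) \<in> parcs (cayley_graph G S)" if "(u, v) \<in> parcs (cayley_graph G S)" for u v
    using that assms(1,2) by (auto simp: cayley_graph_def m_assoc subset_iff intro!: bexI)
  have "\<Gamma>.awalk (g \<otimes> z) (map (map_prod ((\<otimes>) g) ((\<otimes>) g)) p) (g \<otimes> y)"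
    using assms(1,2) arcs p(1)
    by (intro \<Gamma>.awalk_hom pair_wf_digraph_cayley_graph) (auto simp: cayley_graph_def)
  then show ?thesis
    unfolding \<Gamma>.graph_ball_awalk using p(2) by (auto intro!: exI)
qed

lemma (in group) graph_ball_cayley_subset:
  assumes "S \<subseteq> carrier G" "z \<in> carrier G"
  shows "graph_ball (cayley_graph G S) z n \<subseteq> carrier G"
proof -
  interpret \<Gamma>: pair_wf_digraph "cayley_graph G S"
    by (rule pair_wf_digraph_cayley_graph) fact
  show ?thesis
    unfolding \<Gamma>.graph_ball_awalk using \<Gamma>.awalk_last_in_verts by (auto simp: cayley_graph_def)
qed

text \<open>Left multiplication by \<open>z\<close> embeds one ball in the other. This moves
  estimates from the identity, where the transport takes place, to an arbitrary centre.\<close>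

lemma (in group) card_graph_ball_cayley_le:
  assumes "finite S" "S \<subseteq> carrier G" "z \<in> carrier G"
  shows "card (graph_ball (cayley_graph G S) \<one> n) \<le> card (graph_ball (cayley_graph G S) z n)"
proof (rule card_inj_on_le[where f = "\<lambda>y. z \<otimes> y"])
  show "inj_on (\<lambda>y. z \<otimes> y) (graph_ball (cayley_graph G S) \<one> n)"
    using assms graph_ball_cayley_subset[of S \<one> n]
    by (intro inj_onI) (metis Units_eq Units_l_cancel one_closed subsetD)
  show "(\<lambda>y. z \<otimes> y) ` graph_ball (cayley_graph G S) \<one> n \<subseteq> graph_ball (cayley_graph G S) z n"
    using graph_ball_cayley_translate[of S z _ \<one> n] assms by auto
  show "finite (graph_ball (cayley_graph G S) z n)"
    by (rule finite_graph_ball_cayley) fact+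
qed

section \<open>Slowly decaying tails\<close>

text \<open>
  \<open>F\<close> need not be measurable (nor are heights of trees known to be): only measurable functions
  below \<open>F\<close> are integrated.
\<close>
lemma nn_integral_eq_infinity_of_slow_decay:
  fixes F :: "'a \<Rightarrow> ennreal" and f :: "nat \<Rightarrow> real" and \<delta> :: real
  assumes Q: "prob_space Q" and H [measurable]: "\<And>n. H n \<in> sets Q"
    and F: "\<And>n \<omega>. n \<ge> 1 \<Longrightarrow> \<omega> \<in> H n \<Longrightarrow> ennreal (f n) \<le> F \<omega>"
    and F_inf: "\<And>\<omega>. \<exists>\<^sub>\<infinity>n. \<omega> \<in> H n \<Longrightarrow> F \<omega> = \<infinity>"
    and \<delta>: "\<delta> > 0" "\<And>n. n \<ge> 1 \<Longrightarrow> ennreal \<delta> \<le> ennreal (f n) * emeasure Q (H n)"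
  shows "(\<integral>\<^sup>+\<omega>. F \<omega> \<partial>Q) = \<infinity>"
proof (rule ccontr)
  assume fin: "(\<integral>\<^sup>+\<omega>. F \<omega> \<partial>Q) \<noteq> \<infinity>"
  \<comment> \<open>The bounds in \<open>F\<close> and \<open>\<delta>\<close> start at
    \<open>n = 1\<close>, hence the shift by \<open>Suc\<close>.\<close>
  define u where "u n \<omega> = ennreal (f (Suc n)) * indicator (H (Suc n)) \<omega>" for n \<omega>
  have [measurable]: "u n \<in> borel_measurable Q" for n unfolding u_def by measurable
  \<comment> \<open>A measurable majorant of all \<open>u n\<close> that still lies below
    \<open>F\<close>: its integral is finite, so it can dominate.\<close>
  define w where "w \<omega> = (SUP n. u n \<omega>)" for \<omega>
  have [measurable]: "w \<in> borel_measurable Q" unfolding w_def by measurable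
  let ?L = "{\<omega>\<in>space Q. \<exists>\<^sub>\<infinity>n. \<omega> \<in> H n}"
  have L [measurable]: "?L \<in> sets Q" unfolding INFM_nat by measurable
  have u_le: "u n \<omega> \<le> F \<omega>" for n \<omega>
    using F[of "Suc n" \<omega>] by (auto simp: u_def indicator_def)
  have "(\<integral>\<^sup>+\<omega>. w \<omega> \<partial>Q) \<le> (\<integral>\<^sup>+\<omega>. F \<omega> \<partial>Q)"
    by (intro nn_integral_mono) (auto simp: w_def intro!: SUP_least u_le)
  with fin have w_fin: "(\<integral>\<^sup>+\<omega>. w \<omega> \<partial>Q) < \<infinity>"
    by (metis infinity_ennreal_def le_less_trans top.not_eq_extremum)
  \<comment> \<open>\<open>F\<close> is infinite on the limsup event \<open>?L\<close>, so a finite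
    integral forces \<open>?L\<close> to be null; almost everywhere the \<open>u n\<close> then
    vanish eventually.\<close>
  have "\<infinity> * emeasure Q ?L = (\<integral>\<^sup>+\<omega>. \<infinity> * indicator ?L \<omega> \<partial>Q)"
    by (simp add: nn_integral_cmult_indicator)
  also have "\<dots> \<le> (\<integral>\<^sup>+\<omega>. F \<omega> \<partial>Q)"
    by (intro nn_integral_mono) (auto simp: indicator_def F_inf)
  finally have "emeasure Q ?L = 0"
    using fin by (auto simp: ennreal_top_mult top_unique split: if_splits)
  then have "AE \<omega> in Q. \<not> (\<exists>\<^sub>\<infinity>n. \<omega> \<in> H n)"
    by (intro AE_I[of _ _ ?L]) auto
  then have lim: "AE \<omega> in Q. (\<lambda>n. u n \<omega>) \<longlonglongrightarrow> 0"
  proof eventually_elim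
    case (elim \<omega>)
    then have "eventually (\<lambda>n. \<omega> \<notin> H n) sequentially"
      by (simp add: cofinite_eq_sequentially not_frequently)
    then have "eventually (\<lambda>n. \<omega> \<notin> H (Suc n)) sequentially"
      by (rule eventually_sequentially_Suc[THEN iffD2])
    then have "eventually (\<lambda>n. u n \<omega> = 0) sequentially"
      by eventually_elim (simp add: u_def)
    then show ?case by (rule tendsto_eventually)
  qed
  \<comment> \<open>Dominated convergence sends the integrals of \<open>u n\<close> to 0, although
    each of them is at least \<open>\<delta>\<close>.\<close>
  have "(\<lambda>n. \<integral>\<^sup>+\<omega>. u n \<omega> \<partial>Q) \<longlonglongrightarrow> (\<integral>\<^sup>+\<omega>. 0 \<partial>Q)"
    using w_fin lim by (intro nn_integral_dominated_convergence[where w=w]) (auto simp: w_def intro!: SUP_upper)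
  moreover have "ennreal \<delta> \<le> (\<integral>\<^sup>+\<omega>. u n \<omega> \<partial>Q)" for n
    using \<delta>(2)[of "Suc n"] by (simp add: u_def nn_integral_cmult_indicator)
  ultimately have "ennreal \<delta> \<le> (\<integral>\<^sup>+\<omega>. 0 \<partial>Q)"
    by (intro LIMSEQ_le_const[where X="\<lambda>n. \<integral>\<^sup>+\<omega>. u n \<omega> \<partial>Q"]) auto
  then show False using \<delta>(1) by simp
qed

section \<open>Mass transport\<close>

definition (in group) translate :: "'a \<Rightarrow> 'a \<times> nat \<Rightarrow> 'a \<times> nat" where
  "translate g u = (g \<otimes> fst u, snd u)"

text \<open>
  Arcs with the same label \<open>\<epsilon>\<close> share one weight; \<open>\<theta>\<close> is the action of translations on labels.
  This covers both the directed graph (an arc is its own label) and the undirected one (the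
  label of an arc is its pair of endpoints).
\<close>
locale equivariant_layering =
  group G + H: pair_wf_digraph H + M: real_distribution M
  for G :: "('a, 'b) monoid_scheme" (structure)
    and H :: "('a \<times> nat) pair_pre_digraph" and M :: "real measure" +
  fixes S :: "'a set"
    and \<epsilon> :: "('a \<times> nat) \<times> ('a \<times> nat) \<Rightarrow> 'e"
    and \<theta> :: "'a \<Rightarrow> 'e \<Rightarrow> 'e"
  assumes S: "finite S" "S \<subseteq> carrier G"
    and pverts_H: "pverts H = carrier G \<times> UNIV"
    and arc: "((x, m), (y, n)) \<in> parcs H \<Longrightarrow>
      (x = y \<or> (\<exists>s\<in>S. y = x \<otimes> s)) \<and> n \<le> Suc m \<and> m \<le> Suc n"
    and translate_arc: "((x, m), (y, n)) \<in> parcs H \<Longrightarrow> g \<in> carrier G \<Longrightarrow>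
      ((g \<otimes> x, m), (g \<otimes> y, n)) \<in> parcs H"
    and label: "((x, m), (y, n)) \<in> parcs H \<Longrightarrow> g \<in> carrier G \<Longrightarrow>
      \<epsilon> ((g \<otimes> x, m), (g \<otimes> y, n)) = \<theta> g (\<epsilon> ((x, m), (y, n)))"
begin

definition labels :: "'e set" where
  "labels = \<epsilon> ` parcs H"

definition env :: "('e \<Rightarrow> real) measure" where
  "env = PiM labels (\<lambda>_. M)"

definition weight :: "('e \<Rightarrow> real) \<Rightarrow> (('a \<times> nat) \<times> ('a \<times> nat)) list \<Rightarrow> real" where
  "weight \<omega> p = sum_list (map (\<lambda>a. \<omega> (\<epsilon> a)) p)"

text \<open>Minimality is a comparison with each competitor instead of an infimum, so that only
  countably many measurable conditions occur. \<open>K\<close> bounds the length of \<open>p\<close>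
  but not that of the competitors \<open>q\<close>. Ties are permitted: a vertex may have minimal
  paths to several endpoints.\<close>

definition minimal_path ::
    "('e \<Rightarrow> real) \<Rightarrow> 'a \<times> nat \<Rightarrow> nat \<Rightarrow> (('a \<times> nat) \<times> ('a \<times> nat)) list \<Rightarrow> 'a \<Rightarrow> bool" where
  "minimal_path \<omega> u K p x \<longleftrightarrow> H.apath u p (x, 0) \<and> length p \<le> K \<and>
     (\<forall>y q. H.apath u q (y, 0) \<longrightarrow> weight \<omega> p \<le> weight \<omega> q)"

definition hit :: "nat \<Rightarrow> nat \<Rightarrow> 'a \<Rightarrow> 'a \<Rightarrow> ('e \<Rightarrow> real) set" where
  "hit K n y x = {\<omega> \<in> space env. \<exists>p. minimal_path \<omega> (y, n) K p x}"

text \<open>The environment seen from the translated origin. The restriction to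
  \<open>labels\<close> keeps it extensional, hence a point of the product space.\<close>

definition shift :: "'a \<Rightarrow> ('e \<Rightarrow> real) \<Rightarrow> 'e \<Rightarrow> real" where
  "shift g \<omega> = (\<lambda>e\<in>labels. \<omega> (\<theta> g e))"

sublocale env: product_prob_space "\<lambda>_. M" labels
  by standard

sublocale env: prob_space env
  unfolding env_def by (rule env.prob_space_axioms)

lemma apath_awalk: "H.apath u p v \<Longrightarrow> H.awalk u p v"
  by (simp add: H.apath_def)

lemma apath_arcs: "H.apath u p v \<Longrightarrow> set p \<subseteq> parcs H"
  by (auto simp: H.apath_def H.awalk_def)

text \<open>A minimal path attains the infimum \<open>passage_time_base\<close>, so it is a geodesic
  and its starting vertex belongs to the tree. This links the events studied below to heights of
  trees.\<close>

lemma height_tree_ge: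
  assumes "minimal_path \<omega> (y, n) K p x"
  shows "enat n \<le> height (geodesic_tree H (\<lambda>a. \<omega> (\<epsilon> a)) x)"
proof -
  have p: "H.apath (y, n) p (x, 0)"
    and min: "\<And>z q. H.apath (y, n) q (z, 0) \<Longrightarrow> weight \<omega> p \<le> weight \<omega> q"
    using assms by (auto simp: minimal_path_def)
  have x: "(x, 0) \<in> pverts H"
    using p by (auto simp: H.apath_def dest: H.awalk_last_in_verts)
  have "passage_time_base H (\<lambda>a. \<omega> (\<epsilon> a)) (y, n) = ereal (weight \<omega> p)"
  proof (rule antisym)
    show "passage_time_base H (\<lambda>a. \<omega> (\<epsilon> a)) (y, n) \<le> ereal (weight \<omega> p)"
      unfolding passage_time_base_def passage_time_def weight_def
      using x p by (intro INF_lower2[of "(x, 0)"] INF_lower2[of p]) auto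
    show "ereal (weight \<omega> p) \<le> passage_time_base H (\<lambda>a. \<omega> (\<epsilon> a)) (y, n)"
      unfolding passage_time_base_def passage_time_def
      by (intro INF_greatest) (use min in \<open>auto simp: weight_def\<close>)
  qed
  with p have "geodesic_to H (\<lambda>a. \<omega> (\<epsilon> a)) (y, n) p x"
    by (simp add: geodesic_to_def weight_def)
  moreover have "(y, n) \<in> set (pre_digraph.awalk_verts (with_proj H) (y, n) p)"
    using H.hd_in_awalk_verts(2)[OF p] by simp
  ultimately have "(y, n) \<in> geodesic_tree H (\<lambda>a. \<omega> (\<epsilon> a)) x"
    unfolding geodesic_tree_def by blast
  then show ?thesis
    unfolding height_def by (metis SUP_upper snd_conv)
qed

section \<open>Countability of paths and measurability of hitting events\<close>

lemma out_degree:
  assumes "u \<in> pverts H"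
  shows "finite {v. (u, v) \<in> parcs H}" "card {v. (u, v) \<in> parcs H} \<le> 3 * Suc (card S)"
proof -
  obtain x m where u: "u = (x, m)" by (cases u)
  \<comment> \<open>The extra element \<open>x\<close> accounts for vertical arcs. Truncated
    subtraction at \<open>m = 0\<close> merely repeats a level.\<close>
  let ?N = "insert x ((\<lambda>s. x \<otimes> s) ` S) \<times> {m - 1, m, Suc m}"
  have sub: "{v. (u, v) \<in> parcs H} \<subseteq> ?N"
  proof
    fix v assume v: "v \<in> {v. (u, v) \<in> parcs H}"
    obtain y n where yn: "v = (y, n)" by (cases v)
    have "x = y \<or> (\<exists>s\<in>S. y = x \<otimes> s)" and "n \<le> Suc m \<and> m \<le> Suc n"
      using arc[of x m y n] u v yn by auto
    moreover from this(2) have "n = m - 1 \<or> n = m \<or> n = Suc m" by linarith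
    ultimately show "v \<in> ?N" unfolding yn by blast
  qed
  have fin: "finite ?N" using S by auto
  have "card (insert x ((\<lambda>s. x \<otimes> s) ` S)) \<le> Suc (card S)"
    using card_image_le[OF S(1), of "\<lambda>s. x \<otimes> s"] S(1) by (simp add: card_insert_if)
  moreover have "card {m - 1, m, Suc m} \<le> 3"
    by (simp add: card_insert_if)
  ultimately have "card ?N \<le> Suc (card S) * 3"
    unfolding card_cartesian_product by (rule mult_le_mono)
  then show "finite {v. (u, v) \<in> parcs H}" "card {v. (u, v) \<in> parcs H} \<le> 3 * Suc (card S)"
    using finite_subset[OF sub fin] card_mono[OF fin sub] by auto
qed

lemma finite_apaths_of_length:
  assumes "u \<in> pverts H"
  shows "finite {p. length p = k \<and> (\<exists>v. H.apath u p v)}"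
    "card {p. length p = k \<and> (\<exists>v. H.apath u p v)} \<le> (3 * Suc (card S)) ^ k"
proof -
  let ?A = "{p. length p = k \<and> (\<exists>v. H.apath u p v)}"
  let ?W = "{p. length p = k \<and> (\<exists>v. H.awalk u p v)}"
  have W: "finite ?W" "card ?W \<le> (3 * Suc (card S)) ^ k"
    using H.finite_awalks_of_length[OF _ assms, of "3 * Suc (card S)" k] out_degree by auto
  have sub: "?A \<subseteq> ?W" by (auto simp: H.apath_def)
  show "finite ?A" "card ?A \<le> (3 * Suc (card S)) ^ k"
    using finite_subset[OF sub W(1)] card_mono[OF W(1) sub] W(2) by auto
qed

lemma countable_apaths:
  assumes "u \<in> pverts H"
  shows "countable {p. \<exists>v. H.apath u p v}"
proof -
  have eq: "{p. \<exists>v. H.apath u p v} = (\<Union>k. {p. length p = k \<and> (\<exists>v. H.apath u p v)})"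
    by auto
  show ?thesis
    unfolding eq by (rule countable_UN[OF countableI_type])
      (rule countable_finite[OF finite_apaths_of_length(1)[OF assms]])
qed

lemma weight_measurable:
  "set p \<subseteq> parcs H \<Longrightarrow> (\<lambda>\<omega>. weight \<omega> p) \<in> borel_measurable env"
proof (induction p)
  case Nil
  then show ?case by (simp add: weight_def)
next
  case (Cons a p)
  have "(\<lambda>\<omega>. \<omega> (\<epsilon> a)) \<in> measurable env M"
    unfolding env_def using Cons.prems by (intro measurable_component_singleton) (auto simp: labels_def)
  then have "(\<lambda>\<omega>. \<omega> (\<epsilon> a)) \<in> borel_measurable env"
    by (simp cong: measurable_cong_sets)
  moreover have "(\<lambda>\<omega>. weight \<omega> p) \<in> borel_measurable env"
    using Cons by auto
  ultimately have "(\<lambda>\<omega>. \<omega> (\<epsilon> a) + weight \<omega> p) \<in> borel_measurable env" by measurable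
  then show ?case by (simp add: weight_def)
qed

text \<open>Paths from a fixed vertex are countable, so the event is a countable union of countable
  intersections of comparisons between two path weights.\<close>

lemma hit_sets [measurable]:
  assumes "y \<in> carrier G"
  shows "hit K n y x \<in> sets env"
proof -
  let ?u = "(y, n)"
  have u: "?u \<in> pverts H" using assms by (simp add: pverts_H)
  let ?P = "{p. H.apath ?u p (x, 0) \<and> length p \<le> K}"
  let ?Q = "{q. \<exists>z. H.apath ?u q (z, 0)}"
  have c: "countable ?P" "countable ?Q"
    by (rule countable_subset[OF _ countable_apaths[OF u]]; auto)+
  have eq: "hit K n y x = {\<omega> \<in> space env. \<exists>p\<in>?P. \<forall>q\<in>?Q. weight \<omega> p \<le> weight \<omega> q}"
    by (auto simp: hit_def minimal_path_def)
  have "{\<omega> \<in> space env. weight \<omega> p \<le> weight \<omega> q} \<in> sets env"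
    if "p \<in> ?P" "q \<in> ?Q" for p q
    using that by (intro borel_measurable_le weight_measurable) (auto dest: apath_arcs)
  then show ?thesis
    unfolding eq using c
    by (intro sets.sets_Collect_countable_Ex' sets.sets_Collect_countable_All') blast+
qed

section \<open>Translation invariance of the environment\<close>

lemma translate_awalk:
  assumes "H.awalk u p v" "g \<in> carrier G"
  shows "H.awalk (translate g u) (map (map_prod (translate g) (translate g)) p) (translate g v)"
  using assms translate_arc
  by (intro H.awalk_hom H.pair_wf_digraph_axioms)
    (auto simp: pverts_H translate_def split_paired_all)

lemma translate_apath:
  assumes "H.apath u p v" "g \<in> carrier G"
  shows "H.apath (translate g u) (map (map_prod (translate g) (translate g)) p) (translate g v)"
proof -
  have p: "H.awalk u p v" "distinct (pawalk_verts u p)"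
    using assms by (auto simp: H.apath_def)
  have verts: "pawalk_verts (translate g u) (map (map_prod (translate g) (translate g)) p)
      = map (translate g) (pawalk_verts u p)"
    by (induction p arbitrary: u) auto
  have "set (pawalk_verts u p) \<subseteq> pverts H"
    using p(1) by (auto elim!: H.awalkE)
  moreover have "inj_on (translate g) (pverts H)"
    using assms(2) by (auto simp: inj_on_def translate_def pverts_H)
  ultimately have "distinct (map (translate g) (pawalk_verts u p))"
    using p(2) by (auto simp: distinct_map intro: inj_on_subset)
  then show ?thesis
    using translate_awalk[OF p(1) assms(2)] verts by (simp add: H.apath_def)
qed

lemma label_translate:
  assumes "a \<in> parcs H" "g \<in> carrier G"
  shows "\<epsilon> (map_prod (translate g) (translate g) a) = \<theta> g (\<epsilon> a)"
    and "map_prod (translate g) (translate g) a \<in> parcs H"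
  using label[of "fst (fst a)" "snd (fst a)" "fst (snd a)" "snd (snd a)" g]
    translate_arc[of "fst (fst a)" "snd (fst a)" "fst (snd a)" "snd (snd a)" g] assms
  by (cases a; auto simp: translate_def)+

lemma weight_shift:
  assumes "set p \<subseteq> parcs H" "g \<in> carrier G"
  shows "weight (shift g \<omega>) p = weight \<omega> (map (map_prod (translate g) (translate g)) p)"
  using assms by (induction p) (auto simp: weight_def shift_def labels_def label_translate(1))

lemma translate_inverse_arc:
  assumes "a \<in> parcs H" "g \<in> carrier G"
  shows "map_prod (translate (inv g)) (translate (inv g)) (map_prod (translate g) (translate g) a) = a"
    "map_prod (translate g) (translate g) (map_prod (translate (inv g)) (translate (inv g)) a) = a"
proof -
  have "fst (fst a) \<in> carrier G" "fst (snd a) \<in> carrier G"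
    using H.arc_fst_in_verts[OF assms(1)] H.arc_snd_in_verts[OF assms(1)]
    by (auto simp: pverts_H mem_Times_iff)
  then show "map_prod (translate (inv g)) (translate (inv g)) (map_prod (translate g) (translate g) a) = a"
    "map_prod (translate g) (translate g) (map_prod (translate (inv g)) (translate (inv g)) a) = a"
    using assms(2) by (auto simp: translate_def m_assoc[symmetric] prod_eq_iff)
qed

text \<open>The weights are i.i.d., so relabelling by an injection of \<open>labels\<close> into
  itself preserves the product measure.\<close>

lemma distr_shift:
  assumes "g \<in> carrier G"
  shows "shift g \<in> measurable env env" "distr env env (shift g) = env"
proof -
  have to: "\<theta> g e \<in> labels" if "e \<in> labels" for e
    using that label_translate[OF _ assms] by (auto simp: labels_def) (metis imageI)
  \<comment> \<open>Translation by \<open>inv g\<close> undoes translation by \<open>g\<close> on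
    arcs, and every label comes from an arc.\<close>
  have inj: "inj_on (\<theta> g) labels"
  proof (rule inj_on_inverseI)
    fix e assume "e \<in> labels"
    then obtain a where a: "a \<in> parcs H" "e = \<epsilon> a" by (auto simp: labels_def)
    have "\<theta> (inv g) (\<theta> g e) =
        \<epsilon> (map_prod (translate (inv g)) (translate (inv g)) (map_prod (translate g) (translate g) a))"
      using a label_translate[OF a(1) assms] label_translate(1)[of _ "inv g"] assms by simp
    then show "\<theta> (inv g) (\<theta> g e) = e"
      using translate_inverse_arc(1)[OF a(1) assms] a(2) by simp
  qed
  show "shift g \<in> measurable env env"
    unfolding env_def shift_def using to
    by (intro measurable_restrict measurable_component_singleton) auto
  show "distr env env (shift g) = env"
    using distr_PiM_reindex[of labels "\<lambda>_. M" "\<theta> g" labels] inj to M.prob_space_axioms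
    by (simp add: env_def shift_def[abs_def] Pi_def)
qed

text \<open>\<open>shift g\<close> preserves \<open>env\<close>, and a path that is minimal for
  \<open>shift g \<omega>\<close> becomes, after translation by \<open>g\<close>, minimal for
  \<open>\<omega>\<close> itself. This inclusion of events gives the inequality in the direction
  used by the transport.\<close>

lemma emeasure_hit_translate:
  assumes g: "g \<in> carrier G" and y: "y \<in> carrier G"
  shows "emeasure env (hit K n y x) \<le> emeasure env (hit K n (g \<otimes> y) (g \<otimes> x))"
proof -
  have "emeasure env (hit K n y x) = emeasure (distr env env (shift g)) (hit K n y x)"
    using distr_shift[OF g] by simp
  also have "\<dots> = emeasure env (shift g -` hit K n y x \<inter> space env)"
    using distr_shift[OF g] y by (intro emeasure_distr) auto
  also have "\<dots> \<le> emeasure env (hit K n (g \<otimes> y) (g \<otimes> x))"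
  proof (rule emeasure_mono)
    show "shift g -` hit K n y x \<inter> space env \<subseteq> hit K n (g \<otimes> y) (g \<otimes> x)"
    proof safe
      fix \<omega> assume \<omega>: "\<omega> \<in> space env" and "shift g \<omega> \<in> hit K n y x"
      then obtain p where p: "H.apath (y, n) p (x, 0)" "length p \<le> K"
        and min: "\<And>z q. H.apath (y, n) q (z, 0) \<Longrightarrow> weight (shift g \<omega>) p \<le> weight (shift g \<omega>) q"
        by (auto simp: hit_def minimal_path_def)
      let ?p = "map (map_prod (translate g) (translate g)) p"
      have "minimal_path \<omega> (g \<otimes> y, n) K ?p (g \<otimes> x)"
        unfolding minimal_path_def
      proof (intro conjI allI impI)
        show "H.apath (g \<otimes> y, n) ?p (g \<otimes> x, 0)"
          using translate_apath[OF p(1) g] by (simp add: translate_def)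
        show "length ?p \<le> K" using p by simp
        fix z q assume q: "H.apath (g \<otimes> y, n) q (z, 0)"
        \<comment> \<open>An arbitrary competitor is pulled back by \<open>inv g\<close>, compared
          there, and pushed forward again.\<close>
        let ?q = "map (map_prod (translate (inv g)) (translate (inv g))) q"
        have "H.apath (y, n) ?q (inv g \<otimes> z, 0)"
          using translate_apath[OF q, of "inv g"] g y by (simp add: translate_def m_assoc[symmetric])
        moreover from this have "weight (shift g \<omega>) ?q = weight \<omega> (map (map_prod (translate g) (translate g)) ?q)"
          by (intro weight_shift g apath_arcs)
        moreover have "map (map_prod (translate g) (translate g)) ?q = q"
          unfolding map_map comp_def
          using translate_inverse_arc(2)[OF _ g] apath_arcs[OF q] by (intro map_idI) blast
        ultimately show "weight \<omega> ?p \<le> weight \<omega> q"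
          using min weight_shift[OF apath_arcs[OF p(1)] g] by metis
      qed
      with \<omega> show "\<omega> \<in> hit K n (g \<otimes> y) (g \<otimes> x)" by (auto simp: hit_def)
    qed
  qed (use g y in auto)
  finally show ?thesis .
qed

text \<open>Forgetting the level maps an arc to an arc of the Cayley graph or to a single point, so
  the path projects to a walk with at most as many arcs.\<close>

lemma minimal_path_in_ball:
  assumes "minimal_path \<omega> (y, n) K p x"
  shows "x \<in> graph_ball (cayley_graph G S) y K"
proof -
  interpret \<Gamma>: pair_wf_digraph "cayley_graph G S"
    by (rule pair_wf_digraph_cayley_graph) (rule S)
  have "\<exists>q. \<Gamma>.awalk (fst u) q (fst v) \<and> length q \<le> length p" if "H.awalk u p v" for u v
    using that
  proof (induction p arbitrary: u)
    case Nil
    then have "\<Gamma>.awalk (fst u) [] (fst v)"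
      unfolding \<Gamma>.awalk_Nil_iff by (auto simp: H.awalk_Nil_iff pverts_H cayley_graph_def)
    then show ?case by (intro exI[of _ "[]"]) simp
  next
    case (Cons a p)
    then have a: "a \<in> parcs H" "u = fst a" and p: "H.awalk (snd a) p v"
      by (auto simp: H.awalk_Cons_iff)
    from Cons.IH[OF p] obtain q
      where q: "\<Gamma>.awalk (fst (snd a)) q (fst v)" "length q \<le> length p" by auto
    have u: "fst u \<in> carrier G"
      using H.arc_fst_in_verts[OF a(1)] a(2) by (auto simp: pverts_H mem_Times_iff)
    have "fst u = fst (snd a) \<or> (\<exists>s\<in>S. fst (snd a) = fst u \<otimes> s)"
      using arc[of "fst u" "snd u" "fst (snd a)" "snd (snd a)"] a by simp
    then show ?case
    proof
      assume "fst u = fst (snd a)"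
      then show ?thesis using q by (metis le_SucI length_Cons)
    next
      assume "\<exists>s\<in>S. fst (snd a) = fst u \<otimes> s"
      then have "(fst u, fst (snd a)) \<in> parcs (cayley_graph G S)"
        using u by (auto simp: cayley_graph_def)
      then have "\<Gamma>.awalk (fst u) ((fst u, fst (snd a)) # q) (fst v)"
        using q(1) by (simp add: \<Gamma>.awalk_Cons_iff)
      then show ?thesis using q(2) by (metis Suc_le_mono length_Cons)
    qed
  qed
  from this[of "(y, n)" "(x, 0)"] show ?thesis
    using assms unfolding \<Gamma>.graph_ball_awalk
    by (auto simp: minimal_path_def dest!: apath_awalk) (meson order_trans)
qed

text \<open>Only finitely many paths have at most \<open>K\<close> arcs, so one of them is lightest;
  the reference path \<open>p\<close> shows that longer ones cannot beat it. The argument is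
  deterministic, for each fixed \<open>\<omega>\<close>.\<close>

lemma minimal_path_exists:
  assumes u: "u \<in> pverts H" and p: "H.apath u p (x, 0)" "length p \<le> K"
    and long: "\<And>q y. H.apath u q (y, 0) \<Longrightarrow> length q > K \<Longrightarrow> weight \<omega> p \<le> weight \<omega> q"
  shows "\<exists>y q. minimal_path \<omega> u K q y"
proof -
  let ?P = "{q. (\<exists>y. H.apath u q (y, 0)) \<and> length q \<le> K}"
  have "?P \<subseteq> (\<Union>k\<in>{..K}. {q. length q = k \<and> (\<exists>v. H.apath u q v)})"
    by auto
  moreover have "finite (\<Union>k\<in>{..K}. {q. length q = k \<and> (\<exists>v. H.apath u q v)})"
    by (rule finite_UN_I[OF finite_atMost finite_apaths_of_length(1)[OF u]])
  ultimately have "finite ?P" by (rule finite_subset)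
  moreover have pP: "p \<in> ?P" using p by auto
  ultimately obtain q where q: "q \<in> ?P" "\<And>r. r \<in> ?P \<Longrightarrow> weight \<omega> q \<le> weight \<omega> r"
    by (metis (no_types, lifting) arg_min_if_finite(1) arg_min_least empty_iff)
  from q(1) obtain y where y: "H.apath u q (y, 0)" "length q \<le> K" by auto
  have "weight \<omega> q \<le> weight \<omega> r" if r: "H.apath u r (z, 0)" for z r
  proof (cases "length r \<le> K")
    case True
    with r show ?thesis by (intro q(2)) auto
  next
    case False
    then show ?thesis using long[OF r] q(2)[OF pP] by linarith
  qed
  with y have "minimal_path \<omega> u K q y" by (auto simp: minimal_path_def)
  then show ?thesis by blast
qed

text \<open>The event that the tree of \<open>x\<close> is seen to reach level \<open>n\<close>
  through paths with at most \<open>K\<close> arcs. Starting points are written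
  \<open>x \<otimes> inv g\<close> because translation by this element sends the pair
  \<open>(\<one>, g)\<close> to \<open>(x \<otimes> inv g, x)\<close>.\<close>

definition tree_hit :: "nat \<Rightarrow> nat \<Rightarrow> 'a \<Rightarrow> ('e \<Rightarrow> real) set" where
  "tree_hit K n x = (\<Union>g\<in>graph_ball (cayley_graph G S) \<one> K. hit K n (x \<otimes> inv g) x)"

lemma finite_ball: "finite (graph_ball (cayley_graph G S) \<one> K)"
  and ball_carrier: "g \<in> graph_ball (cayley_graph G S) \<one> K \<Longrightarrow> g \<in> carrier G"
  by (rule finite_graph_ball_cayley[OF S one_closed])
    (rule subsetD[OF graph_ball_cayley_subset[OF S(2) one_closed]])

lemma tree_hit_sets [measurable]: "x \<in> carrier G \<Longrightarrow> tree_hit K n x \<in> sets env"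
  unfolding tree_hit_def using finite_ball ball_carrier
  by (intro sets.finite_UN hit_sets) auto

lemma height_ge_if_tree_hit:
  "\<omega> \<in> tree_hit K n x \<Longrightarrow> enat n \<le> height (geodesic_tree H (\<lambda>a. \<omega> (\<epsilon> a)) x)"
  unfolding tree_hit_def hit_def using height_tree_ge by blast

text \<open>The endpoint is confined to a finite ball. The resulting finite union gives
  measurability and prepares the union bound.\<close>

lemma minimal_path_event:
  "{\<omega> \<in> space env. \<exists>g p. minimal_path \<omega> (\<one>, n) K p g} =
    (\<Union>g\<in>graph_ball (cayley_graph G S) \<one> K. hit K n \<one> g)"
  using minimal_path_in_ball by (auto simp: hit_def) blast

lemma minimal_path_event_sets [measurable]:
  "{\<omega> \<in> space env. \<exists>g p. minimal_path \<omega> (\<one>, n) K p g} \<in> sets env"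
  unfolding minimal_path_event using finite_ball by (intro sets.finite_UN) auto

text \<open>The mass transport step: summing over the endpoint \<open>g\<close> and translating each
  term by \<open>x \<otimes> inv g\<close> trades a fixed start with varying endpoint for the fixed
  endpoint \<open>x\<close> with varying start. Every translated event lies in
  \<open>tree_hit\<close>.\<close>

lemma emeasure_minimal_path_le:
  assumes x: "x \<in> carrier G"
  shows "emeasure env {\<omega> \<in> space env. \<exists>g p. minimal_path \<omega> (\<one>, n) K p g}
    \<le> of_nat (card (graph_ball (cayley_graph G S) \<one> K)) * emeasure env (tree_hit K n x)"
proof -
  let ?B = "graph_ball (cayley_graph G S) \<one> K"
  have "emeasure env {\<omega> \<in> space env. \<exists>g p. minimal_path \<omega> (\<one>, n) K p g}
      \<le> (\<Sum>g\<in>?B. emeasure env (hit K n \<one> g))"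
    unfolding minimal_path_event using finite_ball by (intro emeasure_subadditive_finite) auto
  also have "\<dots> \<le> (\<Sum>g\<in>?B. emeasure env (tree_hit K n x))"
  proof (rule sum_mono)
    fix g assume g: "g \<in> ?B"
    then have gc: "g \<in> carrier G" by (rule ball_carrier)
    have "emeasure env (hit K n \<one> g) \<le> emeasure env (hit K n (x \<otimes> inv g) x)"
      using emeasure_hit_translate[of "x \<otimes> inv g" \<one> K n g] x gc by (simp add: m_assoc)
    also have "\<dots> \<le> emeasure env (tree_hit K n x)"
      using g x by (intro emeasure_mono) (auto simp: tree_hit_def intro: tree_hit_sets[unfolded tree_hit_def])
    finally show "emeasure env (hit K n \<one> g) \<le> emeasure env (tree_hit K n x)" .
  qed
  also have "\<dots> = of_nat (card ?B) * emeasure env (tree_hit K n x)" by simp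
  finally show ?thesis .
qed

text \<open>Combines the transport with the tail criterion. \<open>K n\<close> is the length allowed
  to minimal paths from level \<open>n\<close>, \<open>\<delta>\<close> a lower bound for the
  probability that it suffices, and \<open>f n\<close> a lower bound for \<open>\<phi>\<close> at
  heights at least \<open>n\<close>; \<open>C\<close> compares the ball of radius \<open>K n\<close>
  with \<open>f n\<close>.\<close>

lemma nn_integral_height_eq_infinity:
  fixes \<phi> :: "enat \<Rightarrow> ennreal" and f :: "nat \<Rightarrow> real"
  assumes x: "x \<in> carrier G" and "\<delta> > 0" "C > 0"
    and minimal: "\<And>n. n \<ge> 1 \<Longrightarrow>
      ennreal \<delta> \<le> emeasure env {\<omega> \<in> space env. \<exists>g p. minimal_path \<omega> (\<one>, n) (K n) p g}"
    and ball: "\<And>n. n \<ge> 1 \<Longrightarrow> real (card (graph_ball (cayley_graph G S) \<one> (K n))) \<le> C * f n"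
    and \<phi>: "\<And>n h. n \<ge> 1 \<Longrightarrow> enat n \<le> h \<Longrightarrow> ennreal (f n) \<le> \<phi> h" "\<phi> \<infinity> = \<infinity>"
  shows "(\<integral>\<^sup>+\<omega>. \<phi> (height (geodesic_tree H (\<lambda>a. \<omega> (\<epsilon> a)) x)) \<partial>env) = \<infinity>"
proof (rule nn_integral_eq_infinity_of_slow_decay[where H = "\<lambda>n. tree_hit (K n) n x" and f = f and \<delta> = "\<delta> / C"])
  show "prob_space env" by (rule env.prob_space_axioms)
  show "tree_hit (K n) n x \<in> sets env" for n using x by measurable
  show "ennreal (f n) \<le> \<phi> (height (geodesic_tree H (\<lambda>a. \<omega> (\<epsilon> a)) x))"
    if "n \<ge> 1" "\<omega> \<in> tree_hit (K n) n x" for n \<omega>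
    using that by (intro \<phi> height_ge_if_tree_hit)
  show "\<phi> (height (geodesic_tree H (\<lambda>a. \<omega> (\<epsilon> a)) x)) = \<infinity>"
    if inf: "\<exists>\<^sub>\<infinity>n. \<omega> \<in> tree_hit (K n) n x" for \<omega>
  proof (cases "height (geodesic_tree H (\<lambda>a. \<omega> (\<epsilon> a)) x)")
    case (enat m)
    \<comment> \<open>A hit at a level above \<open>m\<close> contradicts height \<open>m\<close>,
      so only infinite height remains.\<close>
    obtain n where "n > m" "\<omega> \<in> tree_hit (K n) n x" using inf by (auto simp: INFM_nat)
    then show ?thesis using height_ge_if_tree_hit[of \<omega> "K n" n x] enat by simp
  qed (use \<phi>(2) in simp)
  show "\<delta> / C > 0" using assms by simp
  show "ennreal (\<delta> / C) \<le> ennreal (f n) * emeasure env (tree_hit (K n) n x)" if n: "n \<ge> 1" for n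
  proof -
    let ?c = "real (card (graph_ball (cayley_graph G S) \<one> (K n)))"
      and ?q = "env.prob (tree_hit (K n) n x)"
    \<comment> \<open>Nonnegativity of \<open>f n\<close> is inherited from the ball bound and
      allows products to be moved between reals and \<open>ennreal\<close>.\<close>
    have "0 \<le> C * f n" using ball[OF n] by linarith
    then have f: "f n \<ge> 0" using \<open>C > 0\<close> by (simp add: zero_le_mult_iff)
    have "ennreal \<delta> \<le> of_nat (card (graph_ball (cayley_graph G S) \<one> (K n))) * ennreal ?q"
      using order_trans[OF minimal[OF n] emeasure_minimal_path_le[OF x]]
      by (simp add: env.emeasure_eq_measure)
    then have "\<delta> \<le> ?c * ?q"
      by (simp add: ennreal_of_nat_eq_real_of_nat ennreal_mult'[symmetric])
    also have "\<dots> \<le> C * f n * ?q" by (intro mult_right_mono ball n) simp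
    finally have "\<delta> / C \<le> f n * ?q" using \<open>C > 0\<close> by (simp add: field_simps)
    then show ?thesis
      using f by (simp add: env.emeasure_eq_measure ennreal_mult'[symmetric])
  qed
qed

end

section \<open>Lengths of minimal paths\<close>

text \<open>As \<open>t\<close> grows, \<open>exp (- t * s)\<close> tends to 0 for every
  \<open>s > 0\<close>, and 0 is not an atom; the constant 1 dominates.\<close>

lemma laplace_transform_small:
  fixes M :: "real measure" and c :: real
  assumes "real_distribution M" "emeasure M {0} = 0" "AE s in M. 0 \<le> s" "c > 0"
  obtains t :: real where "t > 0" "(\<integral>\<^sup>+s. ennreal (exp (- t * s)) \<partial>M) \<le> ennreal c"
proof -
  interpret M: real_distribution M by fact
  have "AE s in M. s \<noteq> 0"
    using assms(2) by (intro AE_I[of _ _ "{0}"]) auto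
  then have lim: "AE s in M. (\<lambda>n. ennreal (exp (- real (Suc n) * s))) \<longlonglongrightarrow> 0"
    using assms(3)
  proof eventually_elim
    case (elim s)
    have "(\<lambda>n. exp (- s) ^ Suc n) \<longlonglongrightarrow> 0"
      using elim by (intro LIMSEQ_Suc LIMSEQ_power_zero) auto
    then have "(\<lambda>n. exp (- real (Suc n) * s)) \<longlonglongrightarrow> 0"
      by (simp add: exp_of_nat_mult[symmetric] del: of_nat_Suc power_Suc)
    then show ?case using tendsto_ennrealI by fastforce
  qed
  have "(\<lambda>n. \<integral>\<^sup>+s. ennreal (exp (- real (Suc n) * s)) \<partial>M) \<longlonglongrightarrow> (\<integral>\<^sup>+s. 0 \<partial>M)"
  proof (rule nn_integral_dominated_convergence[where w = "\<lambda>_. 1"])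
    show "AE s in M. ennreal (exp (- real (Suc n) * s)) \<le> 1" for n
      using assms(3) by eventually_elim (simp add: zero_le_mult_iff del: of_nat_Suc)
    show "AE s in M. (\<lambda>n. ennreal (exp (- real (Suc n) * s))) \<longlonglongrightarrow> 0" by (rule lim)
  qed (use M.emeasure_space_1 in auto)
  then have "eventually (\<lambda>n. (\<integral>\<^sup>+s. ennreal (exp (- real (Suc n) * s)) \<partial>M) < ennreal c) sequentially"
    using assms(4) by (intro order_tendstoD) auto
  then obtain n where "(\<integral>\<^sup>+s. ennreal (exp (- real (Suc n) * s)) \<partial>M) < ennreal c"
    by (auto simp: eventually_sequentially)
  then show thesis by (intro that[of "real (Suc n)"]) auto
qed

context equivariant_layering
begin

text \<open>Distinct labels carry independent weights, so the expectation of the exponential of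
  their sum factorises. Passing to the marginal on the finite label set \<open>?J\<close> makes the
  product formula applicable.\<close>

lemma laplace_transform_weight:
  assumes "set p \<subseteq> parcs H" "distinct (map \<epsilon> p)"
  shows "(\<integral>\<^sup>+\<omega>. ennreal (exp (- t * weight \<omega> p)) \<partial>env) =
    (\<integral>\<^sup>+s. ennreal (exp (- t * s)) \<partial>M) ^ length p"
proof -
  let ?J = "set (map \<epsilon> p)" and ?f = "\<lambda>s. ennreal (exp (- t * s))"
  have J: "finite ?J" "?J \<subseteq> labels" using assms(1) by (auto simp: labels_def)
  have f: "?f \<in> borel_measurable M" by simp
  have prod: "ennreal (exp (- t * weight \<omega> p)) = (\<Prod>e\<in>?J. ?f (restrict \<omega> ?J e))" for \<omega>
  proof -
    have "weight \<omega> p = sum_list (map \<omega> (map \<epsilon> p))" by (simp add: weight_def comp_def)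
    also have "\<dots> = (\<Sum>e\<in>?J. \<omega> e)" using assms(2) by (rule sum_list_distinct_conv_sum_set)
    finally have "exp (- t * weight \<omega> p) = (\<Prod>e\<in>?J. exp (- t * \<omega> e))"
      by (simp add: sum_distrib_left exp_sum)
    then show ?thesis by (simp add: prod_ennreal)
  qed
  have "(\<integral>\<^sup>+\<omega>. ennreal (exp (- t * weight \<omega> p)) \<partial>env)
      = (\<integral>\<^sup>+\<omega>. (\<Prod>e\<in>?J. ?f (restrict \<omega> ?J e)) \<partial>PiM labels (\<lambda>_. M))"
    unfolding prod env_def ..
  also have "\<dots> = (\<integral>\<^sup>+\<omega>. (\<Prod>e\<in>?J. ?f (\<omega> e)) \<partial>distr (PiM labels (\<lambda>_. M)) (PiM ?J (\<lambda>_. M)) (\<lambda>\<omega>. restrict \<omega> ?J))"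
    using J(2) by (subst nn_integral_distr) (auto intro!: measurable_restrict_subset borel_measurable_prod_ennreal)
  also have "\<dots> = (\<integral>\<^sup>+\<omega>. (\<Prod>e\<in>?J. ?f (\<omega> e)) \<partial>PiM ?J (\<lambda>_. M))"
    by (subst env.distr_PiM_restrict_finite[OF J]) simp
  also have "\<dots> = (\<Prod>e\<in>?J. \<integral>\<^sup>+s. ?f s \<partial>M)"
    by (rule env.product_nn_integral_prod[OF J(1) f])
  also have "\<dots> = (\<integral>\<^sup>+s. ?f s \<partial>M) ^ length p"
    using distinct_card[OF assms(2)] by simp
  finally show ?thesis .
qed

text \<open>Chernoff bound: on the event, \<open>exp (length p - t * weight \<omega> p)\<close> is
  at least 1, and its expectation factorises.\<close>

lemma light_path_unlikely:
  assumes p: "set p \<subseteq> parcs H" "distinct (map \<epsilon> p)" and t: "t > 0"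
  shows "emeasure env {\<omega> \<in> space env. weight \<omega> p \<le> length p / t}
    \<le> (ennreal (exp 1) * (\<integral>\<^sup>+s. ennreal (exp (- t * s)) \<partial>M)) ^ length p"
proof -
  note weight_measurable[OF p(1), measurable]
  let ?A = "{\<omega> \<in> space env. weight \<omega> p \<le> length p / t}"
  have "emeasure env ?A = (\<integral>\<^sup>+\<omega>. indicator ?A \<omega> \<partial>env)" by simp
  also have "\<dots> \<le> (\<integral>\<^sup>+\<omega>. ennreal (exp 1 ^ length p) * ennreal (exp (- t * weight \<omega> p)) \<partial>env)"
  proof (rule nn_integral_mono)
    fix \<omega>
    show "indicator ?A \<omega> \<le> ennreal (exp 1 ^ length p) * ennreal (exp (- t * weight \<omega> p))"
    proof (cases "\<omega> \<in> ?A")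
      case True
      then have "0 \<le> real (length p) - t * weight \<omega> p"
        using t by (simp add: field_simps)
      then have "1 \<le> exp (real (length p) - t * weight \<omega> p)" by simp
      also have "\<dots> = exp 1 ^ length p * exp (- t * weight \<omega> p)"
        by (simp add: exp_diff exp_minus exp_of_nat_mult[symmetric] field_simps)
      finally show ?thesis
        using True by (simp add: ennreal_mult'[symmetric])
    qed simp
  qed
  also have "\<dots> = ennreal (exp 1 ^ length p) * (\<integral>\<^sup>+\<omega>. ennreal (exp (- t * weight \<omega> p)) \<partial>env)"
    by (rule nn_integral_cmult) measurable
  also have "\<dots> = (ennreal (exp 1) * (\<integral>\<^sup>+s. ennreal (exp (- t * s)) \<partial>M)) ^ length p"
    unfolding laplace_transform_weight[OF p] by (simp add: power_mult_distrib ennreal_power)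
  finally show ?thesis .
qed

text \<open>A union bound over all lengths: the exponential count of paths is beaten by a small
  Laplace transform. The empty path is left out because both its weight and its length are
  0.\<close>

lemma light_paths_unlikely:
  assumes labels: "\<forall>u p v. H.apath u p v \<longrightarrow> distinct (map \<epsilon> p)"
    and M: "emeasure M {0} = 0" "AE s in M. 0 \<le> s"
  shows "\<exists>a::real>0. \<forall>u\<in>pverts H.
    {\<omega> \<in> space env. \<exists>q v. H.apath u q v \<and> q \<noteq> [] \<and> weight \<omega> q \<le> a * length q} \<in> sets env \<and>
    emeasure env {\<omega> \<in> space env. \<exists>q v. H.apath u q v \<and> q \<noteq> [] \<and> weight \<omega> q \<le> a * length q}
      \<le> ennreal (1 / 4)"
proof -
  define D where "D = 3 * Suc (card S)"
  have D: "D \<ge> 1" by (simp add: D_def)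
  \<comment> \<open>With this \<open>c\<close>, a path with \<open>k\<close> arcs is light with
    probability at most \<open>(1 / (5 * D)) ^ k\<close>; the at most \<open>D ^ k\<close> such
    paths contribute \<open>(1 / 5) ^ k\<close>, and the sum over \<open>k \<ge> 1\<close> is
    \<open>1 / 4\<close>.\<close>
  define c where "c = 1 / (5 * exp 1 * real D)"
  have "c > 0" using D by (simp add: c_def)
  then obtain t where t: "t > 0" and L: "(\<integral>\<^sup>+s. ennreal (exp (- t * s)) \<partial>M) \<le> ennreal c"
    using laplace_transform_small[OF M.real_distribution_axioms M] by blast
  let ?light = "\<lambda>q. {\<omega> \<in> space env. weight \<omega> q \<le> (1 / t) * length q}"
  have light: "?light q \<in> sets env" if "H.apath u q v" for u q v
    using weight_measurable[OF apath_arcs[OF that]] by measurable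
  define W where "W u k = {q. length q = k \<and> (\<exists>v. H.apath u q v)}" for u k
  define B where "B u k = (\<Union>q\<in>W u k. ?light q)" for u k
  let ?B = "\<lambda>u. {\<omega> \<in> space env. \<exists>q v. H.apath u q v \<and> q \<noteq> [] \<and> weight \<omega> q \<le> (1 / t) * length q}"
  have eq: "?B u = (\<Union>k. B u (Suc k))" for u
  proof -
    have "\<omega> \<in> (\<Union>k. B u (Suc k))" if \<omega>: "\<omega> \<in> ?B u" for \<omega>
    proof -
      obtain q v where "\<omega> \<in> space env" "H.apath u q v" "q \<noteq> []" "weight \<omega> q \<le> (1 / t) * length q"
        using \<omega> unfolding mem_Collect_eq by (elim conjE exE)
      then have "q \<in> W u (Suc (length q - 1))" "\<omega> \<in> ?light q"
        unfolding W_def by (simp_all del: split_paired_Ex) blast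
      then have "\<omega> \<in> B u (Suc (length q - 1))" unfolding B_def by blast
      then show ?thesis by blast
    qed
    moreover have "\<omega> \<in> ?B u" if \<omega>: "\<omega> \<in> (\<Union>k. B u (Suc k))" for \<omega>
    proof -
      obtain k q v where "\<omega> \<in> ?light q" "length q = Suc k" "H.apath u q v"
        using \<omega> unfolding B_def W_def by blast
      moreover from this(2) have "q \<noteq> []" by auto
      ultimately show ?thesis by blast
    qed
    ultimately show ?thesis by blast
  qed
  have W: "finite (W u k)" "card (W u k) \<le> D ^ k" if "u \<in> pverts H" for u k
    using finite_apaths_of_length[OF that, of k] unfolding W_def D_def by auto
  have lightW: "?light q \<in> sets env" if "q \<in> W u k" for q u k
    using that light unfolding W_def by blast
  have B_sets: "B u k \<in> sets env" if "u \<in> pverts H" for u k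
    unfolding B_def using W(1)[OF that] by (rule sets.finite_UN) (rule lightW)
  have B_le: "emeasure env (B u k) \<le> ennreal ((1 / 5) ^ k)" if u: "u \<in> pverts H" for u k
  proof -
    have "emeasure env (B u k) \<le> (\<Sum>q\<in>W u k. emeasure env (?light q))"
      unfolding B_def using W(1)[OF u] using lightW by (intro emeasure_subadditive_finite image_subsetI)
    also have "\<dots> \<le> (\<Sum>q\<in>W u k. ennreal ((1 / (5 * real D)) ^ k))"
    proof (rule sum_mono)
      fix q assume q: "q \<in> W u k"
      then obtain v where v: "H.apath u q v" "length q = k" by (auto simp: W_def)
      have "emeasure env (?light q) \<le> (ennreal (exp 1) * (\<integral>\<^sup>+s. ennreal (exp (- t * s)) \<partial>M)) ^ k"
        using light_path_unlikely[OF apath_arcs[OF v(1)] labels[rule_format, OF v(1)] t] v(2) by simp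
      also have "\<dots> \<le> (ennreal (exp 1) * ennreal c) ^ k"
        by (intro power_mono mult_left_mono L) auto
      also have "\<dots> = ennreal ((1 / (5 * real D)) ^ k)"
        using \<open>c > 0\<close> by (simp add: ennreal_mult'[symmetric] ennreal_power c_def)
      finally show "emeasure env (?light q) \<le> ennreal ((1 / (5 * real D)) ^ k)" .
    qed
    also have "\<dots> = ennreal (real (card (W u k)) * (1 / (5 * real D)) ^ k)"
      by (simp add: ennreal_of_nat_eq_real_of_nat ennreal_mult'[symmetric])
    also have "\<dots> \<le> ennreal (real (D ^ k) * (1 / (5 * real D)) ^ k)"
      using W(2)[OF u, of k] by (intro ennreal_leI mult_right_mono) (auto simp del: of_nat_power)
    also have "\<dots> = ennreal ((1 / 5) ^ k)"
      using D by (simp add: power_mult_distrib power_divide)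
    finally show ?thesis .
  qed
  show ?thesis
  proof (intro exI[of _ "1 / t"] conjI ballI)
    show "1 / t > 0" using t by simp
    show "?B u \<in> sets env" if "u \<in> pverts H" for u unfolding eq using B_sets[OF that] by auto
    fix u assume u: "u \<in> pverts H"
    have "emeasure env (\<Union>k. B u (Suc k)) \<le> (\<Sum>k. emeasure env (B u (Suc k)))"
      using B_sets[OF u] by (intro emeasure_subadditive_countably) auto
    also have "\<dots> \<le> (\<Sum>k. ennreal ((1 / 5) ^ Suc k))"
      by (intro suminf_le B_le u) auto
    also have "\<dots> = ennreal (\<Sum>k. (1 / 5) ^ Suc k)"
      by (intro suminf_ennreal2) (auto intro!: summable_mult summable_geometric)
    also have "(\<Sum>k. (1 / 5 :: real) ^ Suc k) = 1 / 4"
      using suminf_mult[of "\<lambda>k. (1 / 5 :: real) ^ k" "1 / 5"] suminf_geometric[of "1 / 5 :: real"]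
      by (simp add: summable_geometric)
    finally show "emeasure env (?B u) \<le> ennreal (1 / 4)" unfolding eq .
  qed
qed

text \<open>Markov's inequality: the expected weight is at most \<open>n * m\<close>, and the term
  \<open>4 * m\<close> in the threshold turns this into \<open>1 / 4\<close>. The summand 1 keeps
  the threshold positive when \<open>m = 0\<close>.\<close>

lemma heavy_path_unlikely:
  assumes p: "set p \<subseteq> parcs H" "length p \<le> n" "n \<ge> 1"
    and m: "(\<integral>\<^sup>+s. ennreal \<bar>s\<bar> \<partial>M) = ennreal m" "m \<ge> 0"
  shows "emeasure env {\<omega> \<in> space env. (4 * m + 1) * n < weight \<omega> p} \<le> ennreal (1 / 4)"
proof -
  note weight_measurable[OF p(1), measurable]
  have abs: "(\<lambda>\<omega>. ennreal \<bar>\<omega> (\<epsilon> a)\<bar>) \<in> borel_measurable env"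
    "(\<integral>\<^sup>+\<omega>. ennreal \<bar>\<omega> (\<epsilon> a)\<bar> \<partial>env) = ennreal m" if "a \<in> parcs H" for a
  proof -
    have a: "\<epsilon> a \<in> labels" using that by (auto simp: labels_def)
    have comp: "(\<lambda>\<omega>. \<omega> (\<epsilon> a)) \<in> measurable env M"
      unfolding env_def using a by (rule measurable_component_singleton)
    have meas: "(\<lambda>s. ennreal \<bar>s\<bar>) \<in> borel_measurable M" by simp
    show "(\<lambda>\<omega>. ennreal \<bar>\<omega> (\<epsilon> a)\<bar>) \<in> borel_measurable env"
      using measurable_compose[OF comp meas] .
    have "ennreal m = (\<integral>\<^sup>+s. ennreal \<bar>s\<bar> \<partial>distr env M (\<lambda>\<omega>. \<omega> (\<epsilon> a)))"
      using env.PiM_component[OF a] m(1) by (simp add: env_def)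
    also have "\<dots> = (\<integral>\<^sup>+\<omega>. ennreal \<bar>\<omega> (\<epsilon> a)\<bar> \<partial>env)"
      by (rule nn_integral_distr[OF comp]) simp
    finally show "(\<integral>\<^sup>+\<omega>. ennreal \<bar>\<omega> (\<epsilon> a)\<bar> \<partial>env) = ennreal m" ..
  qed
  have "(\<lambda>\<omega>. ennreal (weight \<omega> p)) \<in> borel_measurable env \<and>
    (\<integral>\<^sup>+\<omega>. ennreal (weight \<omega> p) \<partial>env) \<le> of_nat (length p) * ennreal m"
    using p(1)
  proof (induction p)
    case Nil
    then show ?case by (simp add: weight_def)
  next
    case (Cons a p)
    have meas: "(\<lambda>\<omega>. ennreal (weight \<omega> (a # p))) \<in> borel_measurable env"
      using weight_measurable[OF Cons.prems] by measurable
    have "(\<integral>\<^sup>+\<omega>. ennreal (weight \<omega> (a # p)) \<partial>env)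
        \<le> (\<integral>\<^sup>+\<omega>. ennreal \<bar>\<omega> (\<epsilon> a)\<bar> + ennreal (weight \<omega> p) \<partial>env)"
    proof (rule nn_integral_mono)
      fix \<omega>
      \<comment> \<open>\<open>ennreal\<close> sends negative reals to 0 and \<open>\<omega>\<close>
        may take negative values, so the pointwise bound goes through absolute values and positive
        parts.\<close>
      have "ennreal (weight \<omega> (a # p)) \<le> ennreal (\<bar>\<omega> (\<epsilon> a)\<bar> + max 0 (weight \<omega> p))"
        by (intro ennreal_leI) (auto simp: weight_def)
      also have "\<dots> = ennreal \<bar>\<omega> (\<epsilon> a)\<bar> + ennreal (max 0 (weight \<omega> p))"
        by (intro ennreal_plus) auto
      finally show "ennreal (weight \<omega> (a # p)) \<le> ennreal \<bar>\<omega> (\<epsilon> a)\<bar> + ennreal (weight \<omega> p)"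
        by (simp add: max_def ennreal_neg split: if_splits)
    qed
    also have "\<dots> = (\<integral>\<^sup>+\<omega>. ennreal \<bar>\<omega> (\<epsilon> a)\<bar> \<partial>env) + (\<integral>\<^sup>+\<omega>. ennreal (weight \<omega> p) \<partial>env)"
      using Cons abs by (intro nn_integral_add) auto
    also have "\<dots> \<le> ennreal m + of_nat (length p) * ennreal m"
      using Cons abs by (intro add_mono) auto
    finally show ?case using meas by (simp add: algebra_simps)
  qed
  then have int: "(\<integral>\<^sup>+\<omega>. ennreal (weight \<omega> p) \<partial>env) \<le> of_nat (length p) * ennreal m" ..
  define b where "b = (4 * m + 1) * real n"
  have b: "b > 0" using p(3) m(2) by (simp add: b_def)
  have "{\<omega> \<in> space env. b < weight \<omega> p} \<subseteq>
      {\<omega> \<in> space env. 1 \<le> ennreal (1 / b) * ennreal (weight \<omega> p)}"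
    using b by (auto simp: ennreal_mult'[symmetric] field_simps)
  then have "emeasure env {\<omega> \<in> space env. b < weight \<omega> p}
      \<le> emeasure env ({\<omega> \<in> space env. 1 \<le> ennreal (1 / b) * ennreal (weight \<omega> p)})"
    by (intro emeasure_mono) measurable
  also have "\<dots> \<le> ennreal (1 / b) * (\<integral>\<^sup>+\<omega>. ennreal (weight \<omega> p) * indicator (space env) \<omega> \<partial>env)"
    using nn_integral_Markov_inequality[of "\<lambda>\<omega>. ennreal (weight \<omega> p)" "space env" env "ennreal (1 / b)"]
    by (simp add: Int_def conj_commute)
  also have "\<dots> = ennreal (1 / b) * (\<integral>\<^sup>+\<omega>. ennreal (weight \<omega> p) \<partial>env)"
    by (intro arg_cong2[where f = times] nn_integral_cong) auto
  also have "\<dots> \<le> ennreal (1 / b) * (of_nat (length p) * ennreal m)"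
    by (intro mult_left_mono int) simp
  also have "\<dots> = ennreal (1 / b * (real (length p) * m))"
    using b m(2) by (simp add: ennreal_mult'[symmetric] ennreal_of_nat_eq_real_of_nat)
  also have "\<dots> \<le> ennreal (1 / b * (real n * m))"
    using p(2) m(2) b by (intro ennreal_leI mult_left_mono mult_right_mono) auto
  also have "\<dots> \<le> ennreal (1 / 4)"
  proof (rule ennreal_leI)
    have "real n * m \<le> b / 4" by (simp add: b_def algebra_simps)
    then have "1 / b * (real n * m) \<le> 1 / b * (b / 4)" using b by (intro mult_left_mono) auto
    then show "1 / b * (real n * m) \<le> 1 / 4" using b by simp
  qed
  finally show ?thesis unfolding b_def .
qed

text \<open>Outside two events of probability at most \<open>1 / 4\<close> each, the reference path
  \<open>p\<close> weighs at most \<open>(4 * m + 1) * n\<close>, while every path with more than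
  \<open>c * n\<close> arcs weighs at least that. A lightest path is then found among those with at
  most \<open>c * n\<close> arcs; \<open>c\<close> does not depend on \<open>n\<close>.\<close>

lemma minimal_path_likely:
  assumes labels: "\<forall>u p v. H.apath u p v \<longrightarrow> distinct (map \<epsilon> p)"
    and M: "emeasure M {0} = 0" "AE s in M. 0 \<le> s" "integrable M (\<lambda>s. s)"
  shows "\<exists>c\<ge>1. \<forall>n\<ge>1. \<forall>p x. H.apath (\<one>, n) p (x, 0) \<and> length p \<le> n \<longrightarrow>
    ennreal (1 / 2) \<le> emeasure env {\<omega> \<in> space env. \<exists>g q. minimal_path \<omega> (\<one>, n) (c * n) q g}"
proof -
  obtain a :: real where a: "a > 0" and light: "\<forall>u\<in>pverts H.
    {\<omega> \<in> space env. \<exists>q v. H.apath u q v \<and> q \<noteq> [] \<and> weight \<omega> q \<le> a * length q} \<in> sets env \<and>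
    emeasure env {\<omega> \<in> space env. \<exists>q v. H.apath u q v \<and> q \<noteq> [] \<and> weight \<omega> q \<le> a * length q}
      \<le> ennreal (1 / 4)"
    using light_paths_unlikely[OF labels M(1,2)] by blast
  define m where "m = (\<integral>s. \<bar>s\<bar> \<partial>M)"
  have m: "(\<integral>\<^sup>+s. ennreal \<bar>s\<bar> \<partial>M) = ennreal m" "m \<ge> 0"
    unfolding m_def using M(3) by (intro nn_integral_eq_integral) auto
  \<comment> \<open>Chosen so that \<open>a * c\<close> is at least the cost
    \<open>4 * m + 1\<close> per level. \<open>Suc\<close> also gives \<open>c \<ge> 1\<close>, so
    that \<open>p\<close> itself has at most \<open>c * n\<close> arcs.\<close>
  define c where "c = Suc (nat \<lceil>(4 * m + 1) / a\<rceil>)"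
  have "(4 * m + 1) / a \<le> real c" unfolding c_def by linarith
  then have c: "4 * m + 1 \<le> a * real c" using a by (simp add: field_simps)
  show ?thesis
  proof (intro exI[of _ c] conjI allI impI; (elim conjE)?)
    show "c \<ge> 1" by (simp add: c_def)
    fix n p x assume n: "n \<ge> 1" and p: "H.apath (\<one>, n) p (x, 0)" "length p \<le> n"
    let ?u = "(\<one>, n)"
    have u: "?u \<in> pverts H" by (simp add: pverts_H)
    let ?L = "{\<omega> \<in> space env. \<exists>q v. H.apath ?u q v \<and> q \<noteq> [] \<and> weight \<omega> q \<le> a * length q}"
    have L: "?L \<in> sets env" "emeasure env ?L \<le> ennreal (1 / 4)" using light u by blast+
    let ?R = "{\<omega> \<in> space env. (4 * m + 1) * n < weight \<omega> p}"
    let ?E = "{\<omega> \<in> space env. \<exists>g q. minimal_path \<omega> ?u (c * n) q g}"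
    have E: "?E \<in> sets env" by (rule minimal_path_event_sets)
    have R: "?R \<in> sets env" using weight_measurable[OF apath_arcs[OF p(1)]] by measurable
    have "\<omega> \<in> ?E" if \<omega>: "\<omega> \<in> space env" "\<omega> \<notin> ?L" "\<omega> \<notin> ?R" for \<omega>
    proof -
      have "weight \<omega> p \<le> weight \<omega> q" if q: "H.apath ?u q (y, 0)" "length q > c * n" for q y
      proof -
        have "weight \<omega> p \<le> (4 * m + 1) * n" using \<omega> by auto
        also have "\<dots> \<le> a * real c * n" using c by (intro mult_right_mono) auto
        also have "\<dots> = a * real (c * n)" by simp
        also have "\<dots> \<le> a * length q" using a q(2) by (intro mult_left_mono) linarith+
        also have "\<dots> \<le> weight \<omega> q" using \<omega>(1,2) q by force
        finally show ?thesis .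
      qed
      moreover have "length p \<le> c * n" using p(2) by (simp add: c_def)
      ultimately show ?thesis
        using minimal_path_exists[OF u p(1), of "c * n" \<omega>] \<omega>(1) by blast
    qed
    then have "space env \<subseteq> ?E \<union> (?L \<union> ?R)" by blast
    then have "emeasure env (space env) \<le> emeasure env (?E \<union> (?L \<union> ?R))"
      using E L(1) R by (intro emeasure_mono sets.Un)
    also have "\<dots> \<le> emeasure env ?E + (emeasure env ?L + emeasure env ?R)"
      using E L(1) R
      by (intro order_trans[OF emeasure_subadditive] add_left_mono emeasure_subadditive sets.Un)
    also have "\<dots> \<le> emeasure env ?E + (ennreal (1 / 4) + ennreal (1 / 4))"
      using heavy_path_unlikely[OF apath_arcs[OF p(1)] p(2) n m] L(2)
      by (intro add_left_mono add_mono)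
    also have "ennreal (1 / 4) + ennreal (1 / 4) = ennreal (1 / 2)"
      by (subst ennreal_plus[symmetric]) auto
    also have "emeasure env ?E + ennreal (1 / 2) = ennreal (env.prob ?E + 1 / 2)"
      unfolding env.emeasure_eq_measure by (subst ennreal_plus) auto
    finally have "ennreal 1 \<le> ennreal (env.prob ?E + 1 / 2)"
      by (simp only: env.emeasure_space_1 ennreal_1)
    then have "1 / 2 \<le> env.prob ?E"
      by (subst (asm) ennreal_le_iff) (auto simp: add_nonneg_nonneg)
    then show "ennreal (1 / 2) \<le> emeasure env ?E"
      unfolding env.emeasure_eq_measure by (rule ennreal_leI)
  qed
qed

end

section \<open>Integer lattices as Cayley graphs\<close>

text \<open>Recasts addition as a group record, so that \<open>int\<close> and
  \<open>int ^ 'd\<close> fall under \<open>cayley_graph\<close>.\<close>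

definition additive_group :: "'a::ab_group_add monoid" where
  "additive_group = \<lparr> carrier = UNIV, mult = (+), one = 0 \<rparr>"

lemma additive_group_simps [simp]:
  "carrier additive_group = UNIV" "x \<otimes>\<^bsub>additive_group\<^esub> y = x + y" "\<one>\<^bsub>additive_group\<^esub> = 0"
  by (auto simp: additive_group_def)

lemma group_additive_group: "group (additive_group :: 'a::ab_group_add monoid)"
  by (rule groupI) (auto simp: add.assoc intro: exI[of _ "- _"])

lemma inv_additive_group [simp]: "inv\<^bsub>additive_group\<^esub> (x :: 'a::ab_group_add) = - x"
  by (rule group.inv_equality[OF group_additive_group]) auto

text \<open>A subadditive function bounded by 1 on the generators grows by at most 1 per arc. It is
  applied to the absolute value and to the l1 norm.\<close>

lemma graph_ball_additive_group_subset:
  fixes N :: "'a::ab_group_add \<Rightarrow> int"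
  assumes "N 0 = 0" "\<And>x y. N (x + y) \<le> N x + N y" "\<And>s. s \<in> S \<Longrightarrow> N s \<le> 1"
  shows "graph_ball (cayley_graph additive_group S) 0 n \<subseteq> {x. N x \<le> int n}"
proof
  interpret \<Gamma>: pair_wf_digraph "cayley_graph additive_group S"
    by (rule group.pair_wf_digraph_cayley_graph[OF group_additive_group]) simp
  have *: "N (y - x) \<le> int (length p)" if "\<Gamma>.awalk x p y" for x p y
    using that
  proof (induction p arbitrary: x)
    case Nil
    then show ?case using assms(1) by (simp add: \<Gamma>.awalk_Nil_iff)
  next
    case (Cons a p)
    then have a: "a \<in> parcs (cayley_graph additive_group S)" "x = fst a"
      and p: "\<Gamma>.awalk (snd a) p y"
      by (auto simp: \<Gamma>.awalk_Cons_iff)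
    then obtain s where s: "s \<in> S" "snd a = x + s" by (auto simp: cayley_graph_def)
    have "N (y - x) = N (s + (y - snd a))" using s by (simp add: algebra_simps)
    also have "\<dots> \<le> N s + N (y - snd a)" by (rule assms(2))
    also have "\<dots> \<le> 1 + int (length p)" by (intro add_mono assms(3) s Cons.IH p)
    finally show ?case by simp
  qed
  fix y assume "y \<in> graph_ball (cayley_graph additive_group S) 0 n"
  then obtain p where p: "\<Gamma>.awalk 0 p y" "length p \<le> n"
    unfolding \<Gamma>.graph_ball_awalk by auto
  then show "y \<in> {x. N x \<le> int n}" using *[OF p(1)] by auto
qed

lemma int_graph_cayley: "int_graph = cayley_graph additive_group {1, - 1}"
  by (auto simp: int_graph_def cayley_graph_def)

lemma lattice_graph_cayley:
  "(lattice_graph :: (int ^ 'd) pair_pre_digraph) = cayley_graph additive_group {s. (\<Sum>i\<in>UNIV. \<bar>s $ i\<bar>) = 1}"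
proof -
  have "((\<Sum>i\<in>UNIV. \<bar>x $ i - y $ i\<bar>) = 1) = (\<exists>s\<in>{s. (\<Sum>i\<in>UNIV. \<bar>s $ i\<bar>) = 1}. y = x + s)"
    for x y :: "int ^ 'd"
  proof
    assume "(\<Sum>i\<in>UNIV. \<bar>x $ i - y $ i\<bar>) = 1"
    then show "\<exists>s\<in>{s. (\<Sum>i\<in>UNIV. \<bar>s $ i\<bar>) = 1}. y = x + s"
      by (intro bexI[of _ "y - x"]) (auto simp: abs_minus_commute)
  qed auto
  then show ?thesis by (simp add: lattice_graph_def cayley_graph_def)
qed

lemma card_int_box_le:
  fixes n :: nat
  shows "finite {v :: int ^ 'd. \<forall>i. \<bar>v $ i\<bar> \<le> int n}"
    and "card {v :: int ^ 'd. \<forall>i. \<bar>v $ i\<bar> \<le> int n} \<le> (2 * n + 1) ^ CARD('d)"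
proof -
  let ?B = "{v :: int ^ 'd. \<forall>i. \<bar>v $ i\<bar> \<le> int n}" and ?P = "PiE (UNIV :: 'd set) (\<lambda>_. {- int n..int n})"
  have P: "finite ?P" by (intro finite_PiE) auto
  have sub: "?B \<subseteq> vec_lambda ` ?P"
  proof
    fix v assume "v \<in> ?B"
    then show "v \<in> vec_lambda ` ?P"
      by (intro image_eqI[of _ _ "vec_nth v"]) (auto simp: vec_nth_inverse abs_le_iff minus_le_iff)
  qed
  show "finite ?B" using finite_subset[OF sub] P by auto
  have "card ?B \<le> card ?P"
    using card_mono[OF _ sub] card_image_le[OF P, of vec_lambda] P by (meson finite_imageI order_trans)
  also have "\<dots> = (2 * n + 1) ^ CARD('d)" by (simp add: card_PiE nat_add_distrib nat_mult_distrib)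
  finally show "card ?B \<le> (2 * n + 1) ^ CARD('d)" .
qed

lemma card_int_ball_le:
  "card (graph_ball (cayley_graph additive_group {1, - 1}) (0 :: int) n) \<le> 2 * n + 1"
proof -
  have "graph_ball (cayley_graph additive_group {1, - 1}) (0 :: int) n \<subseteq> {x. \<bar>x\<bar> \<le> int n}"
    by (rule graph_ball_additive_group_subset) (auto simp: abs_triangle_ineq)
  also have "{x. \<bar>x\<bar> \<le> int n} = {- int n..int n}" by auto
  finally have "card (graph_ball (cayley_graph additive_group {1, - 1}) (0 :: int) n) \<le> card {- int n..int n}"
    by (intro card_mono) auto
  then show ?thesis by simp
qed

lemma l1_ball_subset_box:
  "{v :: int ^ 'd. (\<Sum>i\<in>UNIV. \<bar>v $ i\<bar>) \<le> k} \<subseteq> {v. \<forall>i. \<bar>v $ i\<bar> \<le> k}"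
proof safe
  fix v :: "int ^ 'd" and i
  assume "(\<Sum>i\<in>UNIV. \<bar>v $ i\<bar>) \<le> k"
  moreover have "\<bar>v $ i\<bar> \<le> (\<Sum>i\<in>UNIV. \<bar>v $ i\<bar>)" by (rule member_le_sum) auto
  ultimately show "\<bar>v $ i\<bar> \<le> k" by linarith
qed

lemma finite_lattice_generators: "finite {s :: int ^ 'd. (\<Sum>i\<in>UNIV. \<bar>s $ i\<bar>) = 1}"
proof (rule finite_subset)
  show "{s :: int ^ 'd. (\<Sum>i\<in>UNIV. \<bar>s $ i\<bar>) = 1} \<subseteq> {v. \<forall>i. \<bar>v $ i\<bar> \<le> int 1}"
    by (rule order_trans[OF _ l1_ball_subset_box]) auto
qed (rule card_int_box_le(1))

text \<open>The l1 ball is enclosed in a cube; for the moment only the order of growth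
  \<open>k ^ CARD('d)\<close> matters.\<close>

lemma card_lattice_ball_le:
  "card (graph_ball (cayley_graph additive_group {s :: int ^ 'd. (\<Sum>i\<in>UNIV. \<bar>s $ i\<bar>) = 1}) 0 k)
    \<le> (2 * k + 1) ^ CARD('d)"
proof -
  let ?S = "{s :: int ^ 'd. (\<Sum>i\<in>UNIV. \<bar>s $ i\<bar>) = 1}" and ?N = "\<lambda>v :: int ^ 'd. \<Sum>i\<in>UNIV. \<bar>v $ i\<bar>"
  have "?N (v + w) \<le> ?N v + ?N w" for v w
    by (simp add: sum.distrib[symmetric] sum_mono abs_triangle_ineq)
  then have "graph_ball (cayley_graph additive_group ?S) 0 k \<subseteq> {v. ?N v \<le> int k}"
    by (intro graph_ball_additive_group_subset) auto
  also have "\<dots> \<subseteq> {v. \<forall>i. \<bar>v $ i\<bar> \<le> int k}" by (rule l1_ball_subset_box)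
  finally have "card (graph_ball (cayley_graph additive_group ?S) 0 k) \<le> card {v :: int ^ 'd. \<forall>i. \<bar>v $ i\<bar> \<le> int k}"
    by (intro card_mono card_int_box_le)
  then show ?thesis using card_int_box_le(2)[of k, where 'd = 'd] by linarith
qed

text \<open>Monotonicity in the radius. Finiteness of the balls enters because \<open>card\<close>
  is 0 on infinite sets.\<close>

lemma ball_size_ge:
  assumes "\<And>k. finite (graph_ball \<Gamma> z k)" "enat n \<le> h"
  shows "ennreal (real (card (graph_ball \<Gamma> z n))) \<le> ball_size \<Gamma> z h"
proof (cases h)
  case (enat k)
  then have "card (graph_ball \<Gamma> z n) \<le> card (graph_ball \<Gamma> z k)"
    using assms by (intro card_mono graph_ball_mono) auto
  then show ?thesis
    using enat by (simp add: ball_size_def ennreal_of_nat_eq_real_of_nat)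
qed (simp add: ball_size_def)

section \<open>The directed and the undirected extension\<close>

text \<open>Symmetry of \<open>S\<close> reverses arcs, as arcs of \<open>directed_ext\<close> run
  against those of the Cayley graph it is built from; a generator must exist for a directed walk to
  descend.\<close>

locale first_passage_cayley = group G + M: real_distribution M
  for G :: "('a, 'b) monoid_scheme" (structure) and M :: "real measure" +
  fixes S :: "'a set"
  assumes S: "finite S" "S \<subseteq> carrier G" "S \<noteq> {}" "\<And>s. s \<in> S \<Longrightarrow> inv s \<in> S"
begin

section \<open>Arcs of the Cayley graph and of its two extensions\<close>

lemma pverts_cayley: "pverts (cayley_graph G S) = carrier G"
  by (simp add: cayley_graph_def)

lemma parcs_cayley_iff:
  "(x, y) \<in> parcs (cayley_graph G S) \<longleftrightarrow> x \<in> carrier G \<and> (\<exists>s\<in>S. y = x \<otimes> s)"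
  by (simp add: cayley_graph_def)

lemma cayley_translate:
  assumes "(x, y) \<in> parcs (cayley_graph G S)" "g \<in> carrier G"
  shows "(g \<otimes> x, g \<otimes> y) \<in> parcs (cayley_graph G S)"
proof -
  obtain s where s: "x \<in> carrier G" "s \<in> S" "y = x \<otimes> s"
    using assms(1) unfolding parcs_cayley_iff by blast
  then have "s \<in> carrier G" using S(2) by blast
  with s have "g \<otimes> y = (g \<otimes> x) \<otimes> s" using assms(2) by (simp add: m_assoc)
  then show ?thesis unfolding parcs_cayley_iff using s assms(2) by blast
qed

lemma cayley_arcD:
  assumes "(x, y) \<in> parcs (cayley_graph G S)"
  shows "x \<in> carrier G" "y \<in> carrier G" "\<exists>s\<in>S. y = x \<otimes> s"
proof -
  show "x \<in> carrier G" "\<exists>s\<in>S. y = x \<otimes> s"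
    using assms unfolding parcs_cayley_iff by blast+
  then show "y \<in> carrier G" using S(2) by blast
qed

lemma cayley_sym:
  assumes "(x, y) \<in> parcs (cayley_graph G S)"
  shows "(y, x) \<in> parcs (cayley_graph G S)"
proof -
  obtain s where s: "s \<in> S" "y = x \<otimes> s" using cayley_arcD(3)[OF assms] by blast
  then have "s \<in> carrier G" using S(2) by blast
  with s have "x = y \<otimes> inv s" using cayley_arcD(1)[OF assms] by (simp add: m_assoc)
  then show ?thesis
    unfolding parcs_cayley_iff using cayley_arcD(2)[OF assms] S(4)[OF s(1)] by blast
qed

lemma directed_arc_iff:
  "((x, m), (y, n)) \<in> parcs (directed_ext (cayley_graph G S)) \<longleftrightarrow>
    m = Suc n \<and> (y, x) \<in> parcs (cayley_graph G S)"
  by (auto simp: directed_ext_def)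

lemma undirected_arc_iff:
  "((x, m), (y, n)) \<in> parcs (undirected_ext (cayley_graph G S)) \<longleftrightarrow>
    (x, y) \<in> parcs (cayley_graph G S) \<and> m = n \<and> n \<ge> 1 \<or>
    x \<in> carrier G \<and> x = y \<and> \<bar>int m - int n\<bar> = 1"
  by (simp add: undirected_ext_def pverts_cayley)

sublocale dir: equivariant_layering G "directed_ext (cayley_graph G S)" M S "\<lambda>a. a" "\<lambda>g. map_prod (translate g) (translate g)"
proof unfold_locales
  show verts: "pverts (directed_ext (cayley_graph G S)) = carrier G \<times> UNIV"
    by (simp add: directed_ext_def pverts_cayley)
  fix e assume "e \<in> parcs (directed_ext (cayley_graph G S))"
  then obtain x m y n where e: "e = ((x, m), (y, n))" "(y, x) \<in> parcs (cayley_graph G S)"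
    by (cases e) (auto simp: directed_ext_def)
  show "fst e \<in> pverts (directed_ext (cayley_graph G S))"
    "snd e \<in> pverts (directed_ext (cayley_graph G S))"
    unfolding verts e(1) using cayley_arcD(1,2)[OF e(2)] by simp_all
next
  fix x m y n assume "((x, m), (y, n)) \<in> parcs (directed_ext (cayley_graph G S))"
  then have *: "(y, x) \<in> parcs (cayley_graph G S)" "m = Suc n"
    unfolding directed_arc_iff by blast+
  show "(x = y \<or> (\<exists>s\<in>S. y = x \<otimes> s)) \<and> n \<le> Suc m \<and> m \<le> Suc n"
    using cayley_arcD(3)[OF cayley_sym[OF *(1)]] *(2) by simp
  fix g assume "g \<in> carrier G"
  then show "((g \<otimes> x, m), (g \<otimes> y, n)) \<in> parcs (directed_ext (cayley_graph G S))"
    unfolding directed_arc_iff using cayley_translate * by blast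
qed (simp_all add: translate_def S)

sublocale undir: equivariant_layering G "undirected_ext (cayley_graph G S)" M S "\<lambda>(u, v). {u, v}" "\<lambda>g e. translate g ` e"
proof unfold_locales
  show verts: "pverts (undirected_ext (cayley_graph G S)) = carrier G \<times> UNIV"
    by (simp add: undirected_ext_def pverts_cayley)
  fix e assume "e \<in> parcs (undirected_ext (cayley_graph G S))"
  moreover obtain x m y n where e: "e = ((x, m), (y, n))" by (metis surj_pair)
  ultimately have "x \<in> carrier G" "y \<in> carrier G"
    unfolding e undirected_arc_iff using cayley_arcD(1,2) by blast+
  then show "fst e \<in> pverts (undirected_ext (cayley_graph G S))"
    "snd e \<in> pverts (undirected_ext (cayley_graph G S))"
    unfolding verts e by simp_all
next
  fix x m y n assume a: "((x, m), (y, n)) \<in> parcs (undirected_ext (cayley_graph G S))"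
  then have "n \<le> Suc m" "m \<le> Suc n" unfolding undirected_arc_iff by linarith+
  moreover have "x = y \<or> (\<exists>s\<in>S. y = x \<otimes> s)"
    using a cayley_arcD(3) unfolding undirected_arc_iff by blast
  ultimately show "(x = y \<or> (\<exists>s\<in>S. y = x \<otimes> s)) \<and> n \<le> Suc m \<and> m \<le> Suc n" by blast
  fix g assume "g \<in> carrier G"
  then show "((g \<otimes> x, m), (g \<otimes> y, n)) \<in> parcs (undirected_ext (cayley_graph G S))"
    using a cayley_translate unfolding undirected_arc_iff by blast
qed (simp_all add: translate_def S)

lemma directed_env_eq: "directed_env (cayley_graph G S) M = dir.env"
  by (simp add: directed_env_def dir.env_def dir.labels_def)

lemma undirected_env_eq: "undirected_env (cayley_graph G S) M = undir.env"
proof -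
  have "undirected_edges (undirected_ext (cayley_graph G S)) = undir.labels"
    unfolding undirected_edges_def undir.labels_def by (auto simp: image_def)
  then show ?thesis by (simp add: undirected_env_def undir.env_def)
qed

text \<open>Every arc descends exactly one level, so the end levels determine the length. This is
  what allows \<open>K n = n\<close> in the directed case.\<close>

lemma directed_awalk_length:
  "dir.H.awalk u p v \<Longrightarrow> snd u = snd v + length p"
proof (induction p arbitrary: u)
  case Nil
  then show ?case by (simp add: dir.H.awalk_Nil_iff)
next
  case (Cons a p)
  then have a: "a \<in> parcs (directed_ext (cayley_graph G S))" "u = fst a" and p: "dir.H.awalk (snd a) p v"
    by (auto simp: dir.H.awalk_Cons_iff)
  have "snd (fst a) = Suc (snd (snd a))"
    using a(1) directed_arc_iff[of "fst (fst a)" "snd (fst a)" "fst (snd a)" "snd (snd a)"] by simp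
  with Cons.IH[OF p] a show ?case by simp
qed

lemma directed_apath_exists:
  assumes "x \<in> carrier G"
  shows "\<exists>p y. dir.H.apath (x, n) p (y, 0)"
proof -
  have "\<exists>p y. dir.H.awalk (x, n) p (y, 0)"
    using assms
  proof (induction n arbitrary: x)
    case 0
    then have "dir.H.awalk (x, 0) [] (x, 0)" by (simp add: dir.H.awalk_Nil_iff dir.pverts_H)
    then show ?case by blast
  next
    case (Suc n)
    obtain s where s: "s \<in> S" using S(3) by auto
    then have xs: "(x, x \<otimes> s) \<in> parcs (cayley_graph G S)"
      unfolding parcs_cayley_iff using Suc.prems by blast
    then have arc: "((x, Suc n), (x \<otimes> s, n)) \<in> parcs (directed_ext (cayley_graph G S))"
      unfolding directed_arc_iff using cayley_sym by blast
    obtain p y where "dir.H.awalk (x \<otimes> s, n) p (y, 0)"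
      using Suc.IH[OF cayley_arcD(2)[OF xs]] by blast
    then have "dir.H.awalk (x, Suc n) (((x, Suc n), (x \<otimes> s, n)) # p) (y, 0)"
      using arc by (simp add: dir.H.awalk_Cons_iff)
    then show ?case by blast
  qed
  then show ?thesis using dir.H.apath_awalk_to_apath by blast
qed

text \<open>All paths from level \<open>n\<close> to the base have \<open>n\<close> arcs, so there
  are no longer competitors and the lightest of finitely many paths is minimal in every
  environment.\<close>

lemma directed_minimal_path_exists: "\<exists>g p. dir.minimal_path \<omega> (\<one>, n) n p g"
proof -
  obtain p y where p: "dir.H.apath (\<one>, n) p (y, 0)" using directed_apath_exists[of \<one> n] by auto
  have len: "length q = n" if "dir.H.apath (\<one>, n) q (z, 0)" for q z
    using directed_awalk_length[OF dir.apath_awalk[OF that]] by simp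
  show ?thesis
    by (rule dir.minimal_path_exists[OF _ p]) (use len p in \<open>auto simp: dir.pverts_H\<close>)
qed

text \<open>General \<open>\<phi>\<close> and \<open>f\<close> cover ball sizes in any Cayley graph
  as well as the height itself over the integers. Since minimal paths always exist,
  \<open>\<delta> = 1\<close>.\<close>

lemma directed_height_moment:
  fixes \<phi> :: "enat \<Rightarrow> ennreal" and f :: "nat \<Rightarrow> real"
  assumes "x \<in> carrier G" "C > 0"
    and "\<And>n. n \<ge> 1 \<Longrightarrow> real (card (graph_ball (cayley_graph G S) \<one> n)) \<le> C * f n"
    and "\<And>n h. n \<ge> 1 \<Longrightarrow> enat n \<le> h \<Longrightarrow> ennreal (f n) \<le> \<phi> h" "\<phi> \<infinity> = \<infinity>"
  shows "(\<integral>\<^sup>+\<omega>. \<phi> (height (directed_tree (cayley_graph G S) \<omega> x)) \<partial>directed_env (cayley_graph G S) M) = \<infinity>"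
  unfolding directed_tree_def directed_env_eq
proof (rule dir.nn_integral_height_eq_infinity[where \<delta> = 1 and C = C and K = "\<lambda>n. n" and f = f and \<phi> = \<phi>])
  show "ennreal 1 \<le> emeasure dir.env {\<omega> \<in> space dir.env. \<exists>g p. dir.minimal_path \<omega> (\<one>, n) n p g}" for n
    using directed_minimal_path_exists by (simp add: dir.env.emeasure_space_1)
qed (use assms in auto)

lemma directed_ball_size_moment:
  assumes x: "x \<in> carrier G" and z: "z \<in> carrier G"
  shows "(\<integral>\<^sup>+\<omega>. ball_size (cayley_graph G S) z (height (directed_tree (cayley_graph G S) \<omega> x))
    \<partial>directed_env (cayley_graph G S) M) = \<infinity>"
proof (rule directed_height_moment[where C = 1 and f = "\<lambda>n. real (card (graph_ball (cayley_graph G S) z n))"])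
  show "real (card (graph_ball (cayley_graph G S) \<one> n)) \<le> 1 * real (card (graph_ball (cayley_graph G S) z n))" for n
    using card_graph_ball_cayley_le[OF S(1,2) z] by simp
  show "ennreal (real (card (graph_ball (cayley_graph G S) z n))) \<le> ball_size (cayley_graph G S) z h"
    if "enat n \<le> h" for n h
    by (rule ball_size_ge[OF finite_graph_ball_cayley[OF S(1,2) z] that])
qed (use x in \<open>auto simp: ball_size_def\<close>)

text \<open>If the first edge were used again, in either direction, the starting vertex would be
  revisited, which a path excludes. Distinctness supplies the independence behind the Chernoff
  bound.\<close>

lemma undirected_distinct_labels:
  "undir.H.apath u p v \<Longrightarrow> distinct (map (\<lambda>(u, v). {u, v}) p)"
proof (induction p arbitrary: u)
  case (Cons a p)
  then have p: "undir.H.apath (snd a) p v" and u: "fst a \<notin> set (pawalk_verts (snd a) p)"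
    by (auto simp: undir.H.apath_Cons_iff)
  have "{fst a, snd a} \<noteq> {fst b, snd b}" if "b \<in> set p" for b
    using undir.H.awalk_verts_arc1[OF that, of "snd a"]
      undir.H.awalk_verts_arc2[of "snd a" p v b] that undir.apath_awalk[OF p] u
    by (auto simp: doubleton_eq_iff undir.H.awalk_def)
  then show ?case
    using Cons.IH[OF p] by (auto simp: case_prod_beta)
qed simp

text \<open>Descending vertically gives a walk with \<open>n\<close> arcs, and loop erasure turns it
  into a path without lengthening it. This is the reference path for the Markov bound.\<close>

lemma undirected_apath_exists:
  assumes "x \<in> carrier G"
  shows "\<exists>p. undir.H.apath (x, n) p (x, 0) \<and> length p \<le> n"
proof -
  have "\<exists>p. undir.H.awalk (x, n) p (x, 0) \<and> length p = n"
  proof (induction n)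
    case 0
    then show ?case
      using assms by (auto simp: undir.H.awalk_Nil_iff undir.pverts_H)
  next
    case (Suc n)
    then obtain p where "undir.H.awalk (x, n) p (x, 0)" "length p = n" by auto
    moreover have "((x, Suc n), (x, n)) \<in> parcs (undirected_ext (cayley_graph G S))"
      unfolding undirected_arc_iff using assms by simp
    ultimately have "undir.H.awalk (x, Suc n) (((x, Suc n), (x, n)) # p) (x, 0)
        \<and> length (((x, Suc n), (x, n)) # p) = Suc n"
      by (simp add: undir.H.awalk_Cons_iff)
    then show ?case by blast
  qed
  then obtain p where p: "undir.H.awalk (x, n) p (x, 0)" "length p = n" by auto
  then show ?thesis
    using undir.H.apath_awalk_to_apath[OF p(1)] undir.H.length_awalk_to_apath_le[OF p(1)] by blast
qed

text \<open>The length of minimal paths from level \<open>n\<close> is controlled only up to a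
  factor \<open>c\<close>, and with probability at least \<open>1 / 2\<close>. Hypothesis
  \<open>C\<close> therefore asks that balls of radius \<open>c * n\<close> have size of order
  \<open>f n\<close> for every \<open>c\<close>, as holds in \<open>int ^ 'd\<close> with
  \<open>f n = n ^ CARD('d)\<close>.\<close>

lemma undirected_height_moment:
  fixes \<phi> :: "enat \<Rightarrow> ennreal" and f :: "nat \<Rightarrow> real"
  assumes x: "x \<in> carrier G" and M: "emeasure M {0} = 0" "AE s in M. 0 \<le> s" "integrable M (\<lambda>s. s)"
    and C: "\<And>c. c \<ge> 1 \<Longrightarrow> \<exists>C>0. \<forall>n\<ge>1. real (card (graph_ball (cayley_graph G S) \<one> (c * n))) \<le> C * f n"
    and \<phi>: "\<And>n h. n \<ge> 1 \<Longrightarrow> enat n \<le> h \<Longrightarrow> ennreal (f n) \<le> \<phi> h" "\<phi> \<infinity> = \<infinity>"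
  shows "(\<integral>\<^sup>+\<omega>. \<phi> (height (undirected_tree (cayley_graph G S) \<omega> x)) \<partial>undirected_env (cayley_graph G S) M) = \<infinity>"
proof -
  obtain c where c: "c \<ge> 1" and *: "\<forall>n\<ge>1. \<forall>p x. undir.H.apath (\<one>, n) p (x, 0) \<and> length p \<le> n \<longrightarrow>
      ennreal (1 / 2) \<le> emeasure undir.env {\<omega> \<in> space undir.env. \<exists>g q. undir.minimal_path \<omega> (\<one>, n) (c * n) q g}"
    using undir.minimal_path_likely[OF _ M] undirected_distinct_labels by blast
  obtain C where C: "C > 0" "\<forall>n\<ge>1. real (card (graph_ball (cayley_graph G S) \<one> (c * n))) \<le> C * f n"
    using C[OF c] by auto
  have cost: "(\<lambda>(u, v). \<omega> {u, v}) = (\<lambda>a. \<omega> (case a of (u, v) \<Rightarrow> {u, v}))" for \<omega> :: "('a \<times> nat) set \<Rightarrow> real"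
    by auto
  show ?thesis
    unfolding undirected_tree_def undirected_env_eq cost
  proof (rule undir.nn_integral_height_eq_infinity[where \<delta> = "1 / 2" and C = C and K = "\<lambda>n. c * n" and f = f and \<phi> = \<phi>])
    show "ennreal (1 / 2) \<le> emeasure undir.env {\<omega> \<in> space undir.env. \<exists>g p. undir.minimal_path \<omega> (\<one>, n) (c * n) p g}"
      if "n \<ge> 1" for n
      using * undirected_apath_exists[of \<one> n] that by blast
  qed (use x C \<phi> in auto)
qed

end

theorem theorem1p3:
  fixes M :: "real measure"
  assumes "nonatomic_weight_law M"
  shows
    "(integrable M (\<lambda>s. s) \<longrightarrow>
       (\<forall>(G :: ('a, 'b) monoid_scheme) S.
          group G \<and> infinite (carrier G) \<and> cayley_generators G S \<longrightarrow>
          (\<forall>x\<in>carrier G. \<forall>z\<in>carrier G.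
             (\<integral>\<^sup>+ \<omega>. ball_size (cayley_graph G S) z (height (directed_tree (cayley_graph G S) \<omega> x))
                \<partial>directed_env (cayley_graph G S) M) = \<infinity>)) \<and>
       (\<forall>x :: int.
          (\<integral>\<^sup>+ \<omega>. ennreal_of_enat (height (directed_tree int_graph \<omega> x))
             \<partial>directed_env int_graph M) = \<infinity>))
     \<and>
     ((\<exists>\<nu>>0. (\<integral>\<^sup>+ s. ennreal (exp (\<nu> * s)) \<partial>M) < \<infinity>) \<longrightarrow>
       (\<forall>x :: int ^ 'd.
          (\<integral>\<^sup>+ \<omega>. ennreal_of_enat (height (undirected_tree lattice_graph \<omega> x)) ^ CARD('d)
             \<partial>undirected_env lattice_graph M) = \<infinity>))"
proof (intro conjI impI allI ballI)
  interpret M: real_distribution M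
    using assms by (simp add: nonatomic_weight_law_def)
  have M: "emeasure M {0} = 0" "AE s in M. 0 \<le> s"
    using assms by (auto simp: nonatomic_weight_law_def)
  {
    fix G :: "('a, 'b) monoid_scheme" and S x z
    assume G: "group G \<and> infinite (carrier G) \<and> cayley_generators G S"
      and x: "x \<in> carrier G" and z: "z \<in> carrier G"
    then interpret group G by simp
    \<comment> \<open>The empty set generates only the trivial group, whereas the carrier is
      infinite.\<close>
    have "S \<noteq> {}"
    proof
      assume "S = {}"
      then have "carrier G = {\<one>\<^bsub>G\<^esub>}"
        using G generate_empty by (simp add: cayley_generators_def)
      then show False using G by simp
    qed
    then interpret first_passage_cayley G M S
      using G by unfold_locales (auto simp: cayley_generators_def)
    show "(\<integral>\<^sup>+ \<omega>. ball_size (cayley_graph G S) z (height (directed_tree (cayley_graph G S) \<omega> x))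
        \<partial>directed_env (cayley_graph G S) M) = \<infinity>"
      by (rule directed_ball_size_moment[OF x z])
  next
    fix x :: int
    interpret first_passage_cayley "additive_group :: int monoid" M "{1, - 1}"
      by (intro first_passage_cayley.intro group_additive_group M.real_distribution_axioms
          first_passage_cayley_axioms.intro) auto
    show "(\<integral>\<^sup>+ \<omega>. ennreal_of_enat (height (directed_tree int_graph \<omega> x)) \<partial>directed_env int_graph M) = \<infinity>"
      unfolding int_graph_cayley
    \<comment> \<open>The ball has at most \<open>2 * n + 1\<close> points, and
      \<open>2 * n + 1 \<le> 3 * n\<close> for \<open>n \<ge> 1\<close>.\<close>
    proof (rule directed_height_moment[where C = 3 and f = real])
      show "ennreal (real n) \<le> ennreal_of_enat h" if "enat n \<le> h" for n h
        using that by (cases h) (auto simp: ennreal_of_nat_eq_real_of_nat)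
      show "real (card (graph_ball (cayley_graph (additive_group :: int monoid) {1, - 1}) \<one>\<^bsub>additive_group\<^esub> n)) \<le> 3 * real n"
        if "n \<ge> 1" for n
        using card_int_ball_le[of n] that unfolding additive_group_simps by linarith
    qed auto
  next
    fix x :: "int ^ 'd"
    assume "\<exists>\<nu>>0. (\<integral>\<^sup>+ s. ennreal (exp (\<nu> * s)) \<partial>M) < \<infinity>"
    then obtain \<nu> where \<nu>: "\<nu> > 0" "(\<integral>\<^sup>+ s. ennreal (exp (\<nu> * s)) \<partial>M) < \<infinity>" by auto
    \<comment> \<open>The exponential moment controls the mean through
      \<open>\<nu> * s \<le> exp (\<nu> * s)\<close>.\<close>
    have int: "integrable M (\<lambda>s. s)"
    proof (rule Bochner_Integration.integrable_bound)
      show "integrable M (\<lambda>s. exp (\<nu> * s) / \<nu>)"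
        using \<nu> by (intro integrable_divide integrableI_nonneg) auto
      show "AE s in M. norm s \<le> norm (exp (\<nu> * s) / \<nu>)"
        using M(2)
      proof eventually_elim
        case (elim s)
        have "\<nu> * s \<le> exp (\<nu> * s)" using exp_ge_add_one_self[of "\<nu> * s"] by linarith
        then show ?case using elim \<nu>(1) by (simp add: field_simps)
      qed
    qed simp
    let ?S = "{s :: int ^ 'd. (\<Sum>i\<in>UNIV. \<bar>s $ i\<bar>) = 1}"
    \<comment> \<open>Unit vectors witness that the generating set is nonempty.\<close>
    have "axis i 1 \<in> ?S" for i :: 'd
      by (simp add: axis_def if_distrib cong: if_cong)
    then interpret first_passage_cayley "additive_group :: (int ^ 'd) monoid" M ?S
      using finite_lattice_generators
      by (intro first_passage_cayley.intro group_additive_group M.real_distribution_axioms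
          first_passage_cayley_axioms.intro) auto
    show "(\<integral>\<^sup>+ \<omega>. ennreal_of_enat (height (undirected_tree lattice_graph \<omega> x)) ^ CARD('d)
        \<partial>undirected_env lattice_graph M) = \<infinity>"
      unfolding lattice_graph_cayley
    proof (rule undirected_height_moment[where f = "\<lambda>n. real n ^ CARD('d)" and \<phi> = "\<lambda>h. ennreal_of_enat h ^ CARD('d)", OF _ M int])
      fix c :: nat assume c: "c \<ge> 1"
      \<comment> \<open>For \<open>c, n \<ge> 1\<close> the side \<open>2 * c * n + 1\<close> of the
        enclosing cube is at most \<open>3 * c * n\<close>, which yields the constant
        \<open>(3 * c) ^ CARD('d)\<close>.\<close>
      have "real (card (graph_ball (cayley_graph additive_group ?S) 0 (c * n))) \<le> (3 * c) ^ CARD('d) * real n ^ CARD('d)"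
        if n: "n \<ge> 1" for n
      proof -
        have "1 \<le> c * n" using c n by simp
        then have "2 * (c * n) + 1 \<le> 3 * c * n" by linarith
        then have "(2 * (c * n) + 1) ^ CARD('d) \<le> (3 * c * n) ^ CARD('d)" by (rule power_mono) simp
        with card_lattice_ball_le[of "c * n", where 'd = 'd]
        have "card (graph_ball (cayley_graph additive_group ?S) 0 (c * n)) \<le> (3 * c * n) ^ CARD('d)"
          by (rule order_trans)
        then have "real (card (graph_ball (cayley_graph additive_group ?S) 0 (c * n))) \<le> real ((3 * c * n) ^ CARD('d))"
          by (rule of_nat_mono)
        then show ?thesis by (simp add: power_mult_distrib)
      qed
      then show "\<exists>C>0. \<forall>n\<ge>1. real (card (graph_ball (cayley_graph additive_group ?S) \<one>\<^bsub>additive_group\<^esub> (c * n)))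
          \<le> C * real n ^ CARD('d)"
        using c by (intro exI[of _ "real ((3 * c) ^ CARD('d))"]) auto
    next
      fix n h assume "enat n \<le> h"
      then have "ennreal (real n) \<le> ennreal_of_enat h"
        by (cases h) (auto simp: ennreal_of_nat_eq_real_of_nat)
      then have "ennreal (real n) ^ CARD('d) \<le> ennreal_of_enat h ^ CARD('d)" by (rule power_mono) simp
      then show "ennreal (real n ^ CARD('d)) \<le> ennreal_of_enat h ^ CARD('d)" by (simp add: ennreal_power)
    qed (auto simp: power_eq_top_ennreal)
  }
qed

end
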